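(* Let $\nu$ be a finite measure on $\mathbb{R}$ and $\alpha\in\mathbb{R}$. Denote $A=\alpha\partial_x+\partial_xL_\nu$ and $$D(f,\bar g)(x)=\int_{\mathbb{R}}(\partial f)(x,y)\,(\partial g)(x,y)\,d\nu(y).$$ Then $D(f,\bar g)$ is well-defined for $f,g\in W^{1,\infty}\cap W^{1,2}$, while for $f,g\in W^2$ $$D(f,\bar g)=A(fg)-fA(g)-A(f)g$$ for all $\alpha$ (so that $D$ is the carré du champ operator corresponding to $A$). It follows that for $f\in W^2$, $$\mathrm{Re}\,\langle Af,f\rangle\le0,$$ where $\langle\cdot,\cdot\rangle$ is the inner product of $L^2(\mathbb{R},dx)$, so that $\alpha\partial_x+\partial_xL_\nu$ on $W^2$ is $L^2$-dissipative.
   Context: $\partial f(x,y)=\frac{f(x)-f(y)}{x-y}$ is the difference quotient. For a finite measure $\nu$, $L_\nu f(x)=\int_{\mathbb{R}}\frac{f(x)-f(y)}{x-y}\,d\nu(y)$ and $\partial_xL_\nu f(x)=\int_{\mathbb{R}}\partial_x\frac{f(x)-f(y)}{x-y}\,d\nu(y)$. The functions $f,g$ are complex-valued. $D$ is sesquilinear, i.e. $D(f,g)(x)=\int(\partial f)(x,y)\overline{(\partial g)(x,y)}\,d\nu(y)$; "well-defined" means that the integral converges absolutely for almost every $x$. $C_0(\mathbb{R})$ is the space of continuous functions vanishing at infinity. $W^{1,2}=W^{1,2}(\mathbb{R})$ is the usual Sobolev space ($f,f'\in L^2$); $W^{1,\infty}$ is the space of Lipschitz functions in $C_0(\mathbb{R})$.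 $W^\infty=\{f\in C_0(\mathbb{R}):f''\in C_0(\mathbb{R})\}$ and $W^2=W^\infty\cap W^{1,2}$ (this is not the second-order Sobolev space). *)

theory Defs
  imports "HOL-Analysis.Analysis"
begin

definition in_L2 :: "(real \<Rightarrow> complex) \<Rightarrow> bool" where
  "in_L2 f \<longleftrightarrow> f \<in> borel_measurable lborel \<and> integrable lborel (\<lambda>x. (cmod (f x))\<^sup>2)"

definition L2_inner :: "(real \<Rightarrow> complex) \<Rightarrow> (real \<Rightarrow> complex) \<Rightarrow> complex" where
  "L2_inner f g = (LINT x|lborel. f x * cnj (g x))"

definition L2_norm :: "(real \<Rightarrow> complex) \<Rightarrow> real" where
  "L2_norm f = sqrt (LINT x|lborel. (cmod (f x))\<^sup>2)"

text \<open>The Hille--Yosida notion of dissipativity for an operator \<open>T\<close> in \<open>L\<^sup>2\<close> with domain \<open>S\<close>.\<close>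

definition L2_dissipative ::
    "(real \<Rightarrow> complex) set \<Rightarrow> ((real \<Rightarrow> complex) \<Rightarrow> real \<Rightarrow> complex) \<Rightarrow> bool" where
  "L2_dissipative S T \<longleftrightarrow>
     (\<forall>f\<in>S. in_L2 f \<and> in_L2 (T f) \<and>
        (\<forall>c>0. c * L2_norm f \<le> L2_norm (\<lambda>x. of_real c * f x - T f x)))"

definition C0 :: "(real \<Rightarrow> complex) set" where
  "C0 = {f. continuous_on UNIV f \<and> (f \<longlongrightarrow> 0) at_infinity}"

definition test_fun :: "(real \<Rightarrow> real) \<Rightarrow> bool" where
  "test_fun \<phi> \<longleftrightarrow>
     (\<forall>n x. ((deriv ^^ n) \<phi>) differentiable (at x)) \<and> compact (closure {x. \<phi> x \<noteq> 0})"

definition weak_deriv :: "(real \<Rightarrow> complex) \<Rightarrow> (real \<Rightarrow> complex) \<Rightarrow> bool" where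
  "weak_deriv f g \<longleftrightarrow>
     (\<forall>\<phi>. test_fun \<phi> \<longrightarrow>
        (LINT x|lborel. f x * of_real (deriv \<phi> x)) = - (LINT x|lborel. g x * of_real (\<phi> x)))"

definition W12 :: "(real \<Rightarrow> complex) set" where
  "W12 = {f. in_L2 f \<and> (\<exists>g. in_L2 g \<and> weak_deriv f g)}"

definition W1inf :: "(real \<Rightarrow> complex) set" where
  "W1inf = {f \<in> C0. \<exists>L. L-lipschitz_on UNIV f}"

abbreviation Dx :: "(real \<Rightarrow> complex) \<Rightarrow> real \<Rightarrow> complex" where
  "Dx f x \<equiv> vector_derivative f (at x)"

definition Winf :: "(real \<Rightarrow> complex) set" where
  "Winf = {f \<in> C0. (\<forall>x. f differentiable (at x)) \<and> (\<forall>x. Dx f differentiable (at x)) \<and>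
                   Dx (Dx f) \<in> C0}"

definition W2 :: "(real \<Rightarrow> complex) set" where
  "W2 = Winf \<inter> W12"

text \<open>On the diagonal the difference quotient is extended by continuity. This matters because
  the measure may have atoms. For a function that is merely Lipschitz, the diagonal value can only
  contribute to integrals against the measure at the countably many \<open>x\<close> that are atoms.\<close>

definition diff_quot :: "(real \<Rightarrow> complex) \<Rightarrow> real \<Rightarrow> real \<Rightarrow> complex" where
  "diff_quot f x y = (if x = y then Dx f x else (f x - f y) / of_real (x - y))"

definition dL :: "real measure \<Rightarrow> (real \<Rightarrow> complex) \<Rightarrow> real \<Rightarrow> complex" where
  "dL \<nu> f x = (LINT y|\<nu>. Dx (\<lambda>t. diff_quot f t y) x)"

definition A_op :: "real \<Rightarrow> real measure \<Rightarrow> (real \<Rightarrow> complex) \<Rightarrow> real \<Rightarrow> complex" where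
  "A_op \<alpha> \<nu> f x = of_real \<alpha> * Dx f x + dL \<nu> f x"

text \<open>Since Isabelle's derivatives and integrals are total, the existence of those occurring in
  \<open>A_op\<close> and \<open>D_form\<close> at a point is recorded separately.\<close>

definition A_exists :: "real measure \<Rightarrow> (real \<Rightarrow> complex) \<Rightarrow> real \<Rightarrow> bool" where
  "A_exists \<nu> f x \<longleftrightarrow> f differentiable (at x) \<and>
     (\<forall>y. (\<lambda>t. diff_quot f t y) differentiable (at x)) \<and>
     integrable \<nu> (\<lambda>y. Dx (\<lambda>t. diff_quot f t y) x)"

definition D_form ::
    "real measure \<Rightarrow> (real \<Rightarrow> complex) \<Rightarrow> (real \<Rightarrow> complex) \<Rightarrow> real \<Rightarrow> complex" where
  "D_form \<nu> f g x = (LINT y|\<nu>. diff_quot f x y * cnj (diff_quot g x y))"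

definition D_exists ::
    "real measure \<Rightarrow> (real \<Rightarrow> complex) \<Rightarrow> (real \<Rightarrow> complex) \<Rightarrow> real \<Rightarrow> bool" where
  "D_exists \<nu> f g x \<longleftrightarrow> integrable \<nu> (\<lambda>y. diff_quot f x y * cnj (diff_quot g x y))"

end

theory Submission
  imports Defs "HOL-Probability.Sinc_Integral"
begin

text \<open>The operator is first of all an algebraic object. The quotient rule
\<open>\<partial>(f g)(x, y) = \<partial>f(x, y) g(x) + f(y) \<partial>g(x, y)\<close>, differentiated in \<open>x\<close>, gives
\<open>\<partial>\<^sub>x\<partial>(f g) = f(x) \<partial>\<^sub>x\<partial>g + \<partial>\<^sub>x\<partial>f g(x) + \<partial>f \<partial>g\<close>
(lemma \<open>dx_diff_quot_mult\<close>), because \<open>(x - y) \<partial>\<^sub>x\<partial>g = g'(x) - \<partial>g\<close>. Integration in \<open>y\<close> is the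
carre du champ identity; the derivation \<open>\<alpha> \<partial>\<^sub>x\<close> contributes nothing.

Dissipativity follows from the case \<open>g = cnj f\<close>. The form is then nonnegative and \<open>A\<close> commutes with
conjugation, so \<open>2 Re (A f cnj f) \<le> A(\<bar>f\<bar>\<^sup>2)\<close> pointwise. The integral of \<open>A h\<close> over the line vanishes
for \<open>h = \<bar>f\<bar>\<^sup>2\<close>: for each fixed \<open>y\<close> the integrand \<open>\<partial>\<^sub>x\<partial>h(x, y)\<close> is the \<open>x\<close>-derivative of a function
that vanishes at infinity, and so is \<open>h'\<close>.

The analysis consists in justifying Fubini and \<open>A f \<in> L\<^sup>2\<close>. Both rest on one bound,
\<open>\<bar>\<partial>\<^sub>x\<partial>f(x, y)\<bar> \<le> \<bar>f'(x)\<bar> + C / (1 + (x - y)\<^sup>2)\<close> (lemma \<open>dx_diff_quot_bound\<close>): near the diagonal the left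
side is controlled by \<open>f''\<close>, far from it by \<open>f'\<close> and \<open>f\<close>. The integral of the second term over \<open>x\<close> does
not depend on \<open>y\<close>, and the measure is finite. The bound is useful only if the classical derivative \<open>f'\<close>
is in \<open>L\<^sup>2\<close>, whereas membership in \<open>W12\<close> speaks of a weak derivative. The two agree almost everywhere
(lemma \<open>weak_deriv_unique\<close>), provided that there are enough test functions; these are built from
\<open>exp (- 1 / x)\<close>.\<close>

section \<open>Smooth bumps\<close>

text \<open>The functions of this form with a polynomial \<open>p\<close> are closed under differentiation, so the smoothness
of \<open>exp (- 1 / x)\<close> at \<open>0\<close>, to all orders at once, reduces to a statement about first derivatives.\<close>

definition flat :: "real poly \<Rightarrow> real \<Rightarrow> real" where
  "flat p x = (if 0 < x then poly p (1 / x) * exp (- (1 / x)) else 0)"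

lemma flat_smult: "flat (smult c p) x = c * flat p x"
  by (simp add: flat_def)

text \<open>In the variable \<open>t = 1 / x\<close> this is the decay of \<open>p(t) exp (- t)\<close> at infinity.\<close>

lemma flat_tendsto_0: "(flat p \<longlongrightarrow> 0) (at 0)"
proof -
  have "((\<lambda>t. \<Sum>i\<le>degree p. coeff p i * (t ^ i / exp t)) \<longlongrightarrow> (\<Sum>i\<le>degree p. coeff p i * 0)) at_top"
    by (intro tendsto_intros tendsto_power_div_exp_0)
  then have "((\<lambda>t. poly p t * exp (- t)) \<longlongrightarrow> 0) at_top"
    by (simp add: poly_altdef exp_minus sum_distrib_right divide_inverse mult.assoc)
  from filterlim_compose[OF this filterlim_inverse_at_top_right]
  have r: "((\<lambda>x. poly p (1 / x) * exp (- (1 / x))) \<longlongrightarrow> 0) (at_right 0)"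
    by (simp add: divide_inverse)
  have "(flat p \<longlongrightarrow> 0) (at_right 0)"
    by (rule Lim_transform_eventually[OF r])
       (auto simp: flat_def eventually_at_right_less intro: eventually_at_rightI[of 0 1])
  moreover have "(flat p \<longlongrightarrow> 0) (at_left 0)"
    by (rule Lim_transform_eventually[OF tendsto_const])
       (auto simp: flat_def intro: eventually_at_leftI[of "-1" 0])
  ultimately show ?thesis
    by (simp add: filterlim_at_split)
qed

lemma flat_has_derivative:
  "(flat p has_real_derivative flat (monom 1 2 * (p - pderiv p)) x) (at x)"
proof -
  consider "x > 0" | "x < 0" | "x = 0" by linarith
  then show ?thesis
  proof cases
    case 1
    have "((\<lambda>x. poly p (1 / x) * exp (- (1 / x))) has_real_derivative
            flat (monom 1 2 * (p - pderiv p)) x) (at x)"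
      using 1
      by (auto intro!: derivative_eq_intros DERIV_chain2[OF poly_DERIV]
          simp: flat_def poly_monom field_simps power2_eq_square)
    then show ?thesis
      by (rule has_field_derivative_transform_within_open[of _ _ _ "{0<..}"])
         (use 1 in \<open>auto simp: flat_def\<close>)
  next
    case 2
    have "((\<lambda>x. 0) has_real_derivative flat (monom 1 2 * (p - pderiv p)) x) (at x)"
      using 2 by (simp add: flat_def)
    then show ?thesis
      by (rule has_field_derivative_transform_within_open[of _ _ _ "{..<0}"])
         (use 2 in \<open>auto simp: flat_def\<close>)
  next
    case 3
    have "((\<lambda>h. (flat p (0 + h) - flat p 0) / h) \<longlongrightarrow> 0) (at 0)"
      \<comment> \<open>Dividing by \<open>h\<close> multiplies the polynomial in \<open>1 / h\<close> by its variable.\<close>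
    proof (rule Lim_transform_eventually[OF flat_tendsto_0[of "pCons 0 p"]])
      show "\<forall>\<^sub>F h in at 0. flat (pCons 0 p) h = (flat p (0 + h) - flat p 0) / h"
        by (rule always_eventually) (simp add: flat_def)
    qed
    then show ?thesis
      using 3 by (simp add: DERIV_def flat_def)
  qed
qed

text \<open>An algebra of functions that is stable under \<open>deriv\<close>; every member of such a class is infinitely
differentiable.\<close>

inductive_set flat_algebra :: "(real \<Rightarrow> real) set" where
  affine: "(\<lambda>x. flat p (c * x + d)) \<in> flat_algebra"
| add: "\<lbrakk>\<phi> \<in> flat_algebra; \<psi> \<in> flat_algebra\<rbrakk> \<Longrightarrow> (\<lambda>x. \<phi> x + \<psi> x) \<in> flat_algebra"
| mult: "\<lbrakk>\<phi> \<in> flat_algebra; \<psi> \<in> flat_algebra\<rbrakk> \<Longrightarrow> (\<lambda>x. \<phi> x * \<psi> x) \<in> flat_algebra"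

lemma flat_algebra_has_derivative:
  assumes "\<phi> \<in> flat_algebra"
  shows "\<exists>\<phi>'\<in>flat_algebra. \<forall>x. (\<phi> has_real_derivative \<phi>' x) (at x)"
  using assms
proof induction
  case (affine p c d)
  have "((\<lambda>x. flat p (c * x + d)) has_real_derivative
      flat (smult c (monom 1 2 * (p - pderiv p))) (c * x + d)) (at x)" for x
  proof -
    have "((\<lambda>x. c * x + d) has_real_derivative c) (at x)"
      by (auto intro!: derivative_eq_intros)
    from DERIV_chain2[OF flat_has_derivative this] show ?thesis
      by (simp only: flat_smult mult.commute)
  qed
  then show ?case
    by (intro bexI[OF _ flat_algebra.affine]) blast
next
  case (add \<phi> \<psi>)
  then obtain \<phi>' \<psi>' where "\<phi>' \<in> flat_algebra" "\<psi>' \<in> flat_algebra"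
    "\<forall>x. (\<phi> has_real_derivative \<phi>' x) (at x)" "\<forall>x. (\<psi> has_real_derivative \<psi>' x) (at x)"
    by blast
  then show ?case
    by (intro bexI[of _ "\<lambda>x. \<phi>' x + \<psi>' x"]) (auto intro: DERIV_add flat_algebra.add)
next
  case (mult \<phi> \<psi>)
  then obtain \<phi>' \<psi>' where "\<phi>' \<in> flat_algebra" "\<psi>' \<in> flat_algebra"
    "\<forall>x. (\<phi> has_real_derivative \<phi>' x) (at x)" "\<forall>x. (\<psi> has_real_derivative \<psi>' x) (at x)"
    by blast
  with mult.hyps show ?case
    by (intro bexI[of _ "\<lambda>x. \<phi>' x * \<psi> x + \<psi>' x * \<phi> x"])
       (auto intro: DERIV_mult flat_algebra.add flat_algebra.mult)
qed

lemma flat_algebra_deriv: "\<phi> \<in> flat_algebra \<Longrightarrow> deriv \<phi> \<in> flat_algebra"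
proof -
  assume "\<phi> \<in> flat_algebra"
  then obtain \<phi>' where "\<phi>' \<in> flat_algebra" "\<And>x. (\<phi> has_real_derivative \<phi>' x) (at x)"
    using flat_algebra_has_derivative by blast
  moreover from this(2) have "deriv \<phi> = \<phi>'"
    by (intro ext DERIV_imp_deriv)
  ultimately show ?thesis by simp
qed

lemma flat_algebra_differentiable:
  "\<phi> \<in> flat_algebra \<Longrightarrow> \<phi> differentiable (at x)"
  using flat_algebra_has_derivative real_differentiable_def by blast

lemma flat_algebra_test_fun:
  assumes "\<phi> \<in> flat_algebra" and "{x. \<phi> x \<noteq> 0} \<subseteq> {a..b}"
  shows "test_fun \<phi>"
proof -
  have "(deriv ^^ n) \<phi> \<in> flat_algebra" for n
    by (induction n) (auto simp: assms flat_algebra_deriv)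
  moreover have "bounded {x. \<phi> x \<noteq> 0}"
    using assms(2) bounded_closed_interval bounded_subset by blast
  ultimately show ?thesis
    by (auto simp: test_fun_def flat_algebra_differentiable compact_closure)
qed

text \<open>The arguments are \<open>(n + 1) (x - a)\<close> and \<open>(n + 1) (b - x)\<close>, in the shape of an affine generator of
\<open>flat_algebra\<close>. As \<open>n\<close> grows, both exponents tend to \<open>0\<close> inside the interval, so the bumps converge to
its indicator function.\<close>

definition bump :: "real \<Rightarrow> real \<Rightarrow> nat \<Rightarrow> real \<Rightarrow> real" where
  "bump a b n x = flat 1 (real (Suc n) * x + - (real (Suc n) * a)) * flat 1 (- real (Suc n) * x + real (Suc n) * b)"

lemma bump_eq:
  "bump a b n x = (if a < x \<and> x < b
     then exp (- (inverse (real (Suc n)) * (1 / (x - a)))) * exp (- (inverse (real (Suc n)) * (1 / (b - x)))) else 0)"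
proof -
  have *: "flat 1 (real (Suc n) * s) = (if 0 < s then exp (- (inverse (real (Suc n)) * (1 / s))) else 0)" for s
    unfolding flat_def by (simp add: zero_less_mult_iff divide_inverse mult.commute del: of_nat_Suc)
  have "bump a b n x = flat 1 (real (Suc n) * (x - a)) * flat 1 (real (Suc n) * (b - x))"
    by (simp add: bump_def algebra_simps)
  then show ?thesis
    unfolding * by simp
qed

lemma test_fun_bump: "test_fun (bump a b n)"
proof (rule flat_algebra_test_fun)
  show "bump a b n \<in> flat_algebra"
    unfolding bump_def[abs_def] by (intro flat_algebra.intros)
  show "{x. bump a b n x \<noteq> 0} \<subseteq> {a..b}"
    by (auto simp: bump_eq split: if_splits)
qed

lemma bump_bounds: "\<bar>bump a b n x\<bar> \<le> indicator {a<..<b} x"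
  by (auto simp: bump_eq abs_mult intro!: mult_le_one)

lemma bump_tendsto_indicator: "(\<lambda>n. bump a b n x) \<longlonglongrightarrow> indicator {a<..<b} x"
proof (cases "a < x \<and> x < b")
  case True
  have "(\<lambda>n. exp (- (inverse (real (Suc n)) * (1 / (x - a)))) * exp (- (inverse (real (Suc n)) * (1 / (b - x)))))
      \<longlonglongrightarrow> exp (- (0 * (1 / (x - a)))) * exp (- (0 * (1 / (b - x))))"
    by (intro tendsto_intros LIMSEQ_inverse_real_of_nat)
  with True show ?thesis by (simp add: bump_eq del: of_nat_Suc)
qed (auto simp: bump_eq)

section \<open>Weak derivatives\<close>

text \<open>The integral over \<open>[-n, n]\<close> is \<open>F(n) - F(-n)\<close>, by the fundamental theorem for the gauge integral,
which covers every derivative. In particular it covers \<open>\<partial>\<^sub>x\<partial>f(x, y)\<close>, whose formula changes at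
\<open>x = y\<close>.\<close>

lemma integral_derivative_eq_0:
  fixes F :: "real \<Rightarrow> 'a :: euclidean_space"
  assumes deriv: "\<And>x. (F has_vector_derivative F' x) (at x)"
    and int: "integrable lborel F'"
    and lim: "(F \<longlongrightarrow> 0) at_infinity"
  shows "(LINT x|lborel. F' x) = 0"
proof -
  have si: "set_integrable lborel {- real n..real n} F'" for n
    using int unfolding set_integrable_def by (intro integrable_mult_indicator) auto
  have eq: "(LINT x|lborel. indicator {- real n..real n} x *\<^sub>R F' x) = F (real n) - F (- real n)" for n
  proof -
    have "(F' has_integral (F (real n) - F (- real n))) {- real n..real n}"
      by (rule fundamental_theorem_of_calculus)
         (auto intro: has_vector_derivative_at_within deriv)
    with set_borel_integral_eq_integral(2)[OF si[of n]] show ?thesis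
      by (simp add: set_lebesgue_integral_def integral_unique)
  qed
  have "(\<lambda>n. LINT x|lborel. indicator {- real n..real n} x *\<^sub>R F' x) \<longlonglongrightarrow> (LINT x|lborel. F' x)"
  proof (rule integral_dominated_convergence[where w = "\<lambda>x. norm (F' x)"])
    show "AE x in lborel. (\<lambda>n. indicator {- real n..real n} x *\<^sub>R F' x) \<longlonglongrightarrow> F' x"
    proof (rule AE_I2, rule tendsto_eventually)
      fix x :: real
      obtain N where "\<bar>x\<bar> \<le> real N" using real_arch_simple by blast
      then show "\<forall>\<^sub>F n in sequentially. indicator {- real n..real n} x *\<^sub>R F' x = F' x"
        by (intro eventually_sequentiallyI[of N]) (auto simp: indicator_def)
    qed
  qed (use int in \<open>auto simp: indicator_def\<close>)
  moreover have "(\<lambda>n. F (real n) - F (- real n)) \<longlonglongrightarrow> 0 - 0"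
    by (intro tendsto_diff filterlim_compose[OF lim] filterlim_at_top_imp_at_infinity
        filterlim_at_bot_imp_at_infinity filterlim_real_sequentially
        filterlim_compose[OF filterlim_uminus_at_bot_at_top filterlim_real_sequentially])
  ultimately show ?thesis
    unfolding eq using LIMSEQ_unique by fastforce
qed

lemma test_fun_support:
  assumes "test_fun \<phi>"
  obtains c where "\<And>x. c < \<bar>x\<bar> \<Longrightarrow> \<phi> x = 0"
proof -
  have "bounded {x. \<phi> x \<noteq> 0}"
    using assms bounded_subset[OF compact_imp_bounded closure_subset] unfolding test_fun_def by simp
  then obtain c where "\<forall>x\<in>{x. \<phi> x \<noteq> 0}. \<bar>x\<bar> \<le> c"
    unfolding bounded_iff by auto
  then show ?thesis using that[of c] by force
qed

lemma integrable_continuous_compact_support: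
  fixes h :: "real \<Rightarrow> 'a :: {banach, second_countable_topology}"
  assumes "continuous_on UNIV h" and "\<And>x. c < \<bar>x\<bar> \<Longrightarrow> h x = 0"
  shows "integrable lborel h"
proof -
  have "integrable lborel (\<lambda>x. indicator {-c..c} x *\<^sub>R h x)"
    by (rule borel_integrable_compact) (use assms(1) continuous_on_subset in auto)
  also have "(\<lambda>x. indicator {-c..c} x *\<^sub>R h x) = h"
    using assms(2) by (fastforce simp: indicator_def fun_eq_iff)
  finally show ?thesis .
qed

lemma weak_deriv_classical:
  assumes f: "\<And>x. (f has_vector_derivative f' x) (at x)" and f': "continuous_on UNIV f'"
  shows "weak_deriv f f'"
  unfolding weak_deriv_def
proof (intro allI impI)
  fix \<phi> assume \<phi>: "test_fun \<phi>"
  have diff: "\<phi> differentiable (at x)" "deriv \<phi> differentiable (at x)" for x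
    using \<phi> unfolding test_fun_def
    by (metis funpow_0, metis funpow_0 funpow.simps(2) comp_apply)
  then have d: "(\<phi> has_real_derivative deriv \<phi> x) (at x)" for x
    by (simp add: DERIV_deriv_iff_real_differentiable)
  from diff have c: "isCont \<phi> x" "isCont (deriv \<phi>) x" for x
    by (simp_all only: differentiable_imp_continuous_within)
  obtain c where c0: "\<And>x. c < \<bar>x\<bar> \<Longrightarrow> \<phi> x = 0"
    using test_fun_support[OF \<phi>] by blast
  have c1: "deriv \<phi> x = 0" if "c < \<bar>x\<bar>" for x
  proof -
    have "((\<lambda>x. 0) has_real_derivative deriv \<phi> x) (at x)"
      by (rule has_field_derivative_transform_within_open[OF d, of "{x. c < \<bar>x\<bar>}"])
         (use that c0 in \<open>auto intro!: open_Collect_less continuous_intros\<close>)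
    then show ?thesis using DERIV_unique DERIV_const by blast
  qed
  have fc: "continuous_on UNIV f"
    using f by (auto intro!: continuous_at_imp_continuous_on has_vector_derivative_continuous)
  have c2: "continuous_on UNIV \<phi>" "continuous_on UNIV (deriv \<phi>)"
    using c by (auto intro!: continuous_at_imp_continuous_on)
  have i1: "integrable lborel (\<lambda>x. f x * of_real (deriv \<phi> x))"
    by (rule integrable_continuous_compact_support[where c = c])
       (use fc c2 c1 in \<open>auto intro!: continuous_intros\<close>)
  have i2: "integrable lborel (\<lambda>x. f' x * of_real (\<phi> x))"
    by (rule integrable_continuous_compact_support[where c = c])
       (use f' c2 c0 in \<open>auto intro!: continuous_intros\<close>)
  have "(LINT x|lborel. f x * of_real (deriv \<phi> x) + f' x * of_real (\<phi> x)) = 0"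
  proof (rule integral_derivative_eq_0)
    show "((\<lambda>x. f x * of_real (\<phi> x)) has_vector_derivative
        f x * of_real (deriv \<phi> x) + f' x * of_real (\<phi> x)) (at x)" for x
      by (rule has_vector_derivative_mult f has_vector_derivative_of_real
          d)+
    have "\<forall>\<^sub>F x in at_infinity. 0 = f x * of_real (\<phi> x)"
      unfolding eventually_at_infinity
      by (rule exI[of _ "c + 1"]) (auto simp: c0)
    then show "((\<lambda>x. f x * of_real (\<phi> x)) \<longlongrightarrow> 0) at_infinity"
      by (rule Lim_transform_eventually[OF tendsto_const])
  qed (use i1 i2 in auto)
  with i1 i2 show "(LINT x|lborel. f x * of_real (deriv \<phi> x)) = - (LINT x|lborel. f' x * of_real (\<phi> x))"
    by (simp add: eq_neg_iff_add_eq_0)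
qed

text \<open>Open intervals form an intersection-stable generator of the Borel sets, and the sets on which the
integral of \<open>u\<close> vanishes are closed under complement and countable disjoint union.\<close>

lemma AE_eq_0_of_interval_integrals:
  fixes u :: "real \<Rightarrow> 'a :: {banach, second_countable_topology}"
  assumes u: "integrable lborel u"
    and zero: "\<And>a b. (LINT x:{a<..<b}|lborel. u x) = 0"
  shows "AE x in lborel. u x = 0"
proof (rule sigma_finite_measure.density_zero[OF sigma_finite_lborel u])
  have si: "set_integrable lborel A u" if "A \<in> sets lborel" for A
    using u that unfolding set_integrable_def by (intro integrable_mult_indicator)
  have total: "(LINT x|lborel. u x) = 0"
  proof -
    have "(\<lambda>n. LINT x:{- real n<..<real n}|lborel. u x) \<longlonglongrightarrow> (LINT x|lborel. u x)"
      unfolding set_lebesgue_integral_def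
    proof (rule integral_dominated_convergence[where w = "\<lambda>x. norm (u x)"])
      show "AE x in lborel. (\<lambda>n. indicator {- real n<..<real n} x *\<^sub>R u x) \<longlonglongrightarrow> u x"
      proof (rule AE_I2, rule tendsto_eventually)
        fix x :: real
        obtain N where "\<bar>x\<bar> < real N" using reals_Archimedean2 by blast
        then show "\<forall>\<^sub>F n in sequentially. indicator {- real n<..<real n} x *\<^sub>R u x = u x"
          by (intro eventually_sequentiallyI[of N]) (auto simp: indicator_def)
      qed
    qed (use u in \<open>auto simp: indicator_def\<close>)
    then show ?thesis
      unfolding zero using LIMSEQ_unique tendsto_const by blast
  qed
  have stable: "Int_stable (range (\<lambda>(a, b). {a<..<b::real}))"
    by (auto simp: Int_stable_def)
  have subset_Pow: "range (\<lambda>(a, b). {a<..<b::real}) \<subseteq> Pow UNIV"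
    by simp
  fix A :: "real set" assume "A \<in> sets lborel"
  then have "A \<in> sigma_sets UNIV (range (\<lambda>(a, b). {a<..<b}))"
    by (simp add: borel_eq_box box_real)
  then show "(LINT x:A|lborel. u x) = 0"
  proof (induction rule: sigma_sets_induct_disjoint[OF stable subset_Pow, consumes 1, case_names basic empty compl union])
    case (compl A)
    then have A: "A \<in> sets lborel" by (simp add: borel_eq_box box_real)
    have "(LINT x:A \<union> (UNIV - A)|lborel. u x) = (LINT x:A|lborel. u x) + (LINT x:UNIV - A|lborel. u x)"
      using A by (intro set_integral_Un si) auto
    moreover have "(LINT x:A \<union> (UNIV - A)|lborel. u x) = 0"
      using total by (simp add: set_lebesgue_integral_def)
    ultimately show ?case
      using compl.IH by simp
  next
    case (union A)
    have A: "A i \<in> sets lborel" for i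
      using union.hyps(2) by (auto simp: borel_eq_box box_real)
    have "(LINT x:(\<Union>i. A i)|lborel. u x) = (\<Sum>i. LINT x:A i|lborel. u x)"
    proof (rule lebesgue_integral_countable_add)
      show "A i \<inter> A j = {}" if "i \<noteq> j" for i j
        using union.hyps(1) that by (auto simp: disjoint_family_on_def)
      show "set_integrable lborel (\<Union>i. A i) u"
        using A by (intro si sets.countable_UN) auto
    qed (rule A)
    then show ?case
      by (simp only: union.IH suminf_zero)
  next
    case (basic A)
    then show ?case using zero by auto
  next
    case empty
    show ?case by (simp add: set_lebesgue_integral_def)
  qed
qed

text \<open>On a bounded interval, \<open>\<bar>g\<bar> \<le> 1 + \<bar>g\<bar>\<^sup>2\<close> is an integrable majorant.\<close>

lemma in_L2_set_integrable:
  assumes "in_L2 g"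
  shows "set_integrable lborel {a<..<b} g"
  unfolding set_integrable_def
proof (rule Bochner_Integration.integrable_bound)
  show "integrable lborel (\<lambda>x. indicator {a<..<b} x + (cmod (g x))\<^sup>2 :: real)"
    using assms unfolding in_L2_def
    by (cases "a \<le> b"; intro Bochner_Integration.integrable_add integrable_real_indicator) auto
  show "AE x in lborel. norm (indicator {a<..<b} x *\<^sub>R g x) \<le> norm (indicator {a<..<b} x + (cmod (g x))\<^sup>2 :: real)"
  proof (rule AE_I2)
    fix x
    have "cmod (g x) * 1 \<le> 1 + (cmod (g x))\<^sup>2"
      using sum_squares_bound[of "cmod (g x)" 1] norm_ge_zero[of "g x"]
      unfolding mult_1_right power_one by linarith
    then show "norm (indicator {a<..<b} x *\<^sub>R g x) \<le> norm (indicator {a<..<b} x + (cmod (g x))\<^sup>2 :: real)"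
      by (auto simp: indicator_def)
  qed
qed (use assms in \<open>auto simp: in_L2_def\<close>)

text \<open>Testing against bumps that converge to the indicator function of an interval shows that \<open>g\<close> and \<open>h\<close>
have equal integrals over every bounded interval. As they are only locally integrable, their difference
is cut off to \<open>(-n, n)\<close> before it is shown to vanish.\<close>

lemma weak_deriv_unique:
  assumes f: "weak_deriv f g" "weak_deriv f h"
    and g: "\<And>a b. set_integrable lborel {a<..<b} g" and h: "\<And>a b. set_integrable lborel {a<..<b} h"
    and m: "g \<in> borel_measurable lborel" "h \<in> borel_measurable lborel"
  shows "AE x in lborel. g x = h x"
proof -
  have lim: "(\<lambda>n. LINT x|lborel. w x * of_real (bump a b n x)) \<longlonglongrightarrow> (LINT x:{a<..<b}|lborel. w x)"
    if w: "\<And>a b. set_integrable lborel {a<..<b} w" and [measurable]: "w \<in> borel_measurable lborel"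
    for w :: "real \<Rightarrow> complex" and a b
    unfolding set_lebesgue_integral_def
  proof (rule integral_dominated_convergence[where w = "\<lambda>x. norm (indicator {a<..<b} x *\<^sub>R w x)"])
    have [measurable]: "bump a b n \<in> borel_measurable borel" for n
      unfolding bump_eq[abs_def] by measurable
    show "(\<lambda>x. w x * of_real (bump a b n x)) \<in> borel_measurable lborel" for n
      by measurable
    show "integrable lborel (\<lambda>x. norm (indicator {a<..<b} x *\<^sub>R w x))"
      using w[of a b] unfolding set_integrable_def by (rule integrable_norm)
    show "AE x in lborel. (\<lambda>n. w x * of_real (bump a b n x)) \<longlonglongrightarrow> indicator {a<..<b} x *\<^sub>R w x"
    proof (rule AE_I2)
      fix x
      have "(\<lambda>n. w x * of_real (bump a b n x)) \<longlonglongrightarrow> w x * of_real (indicator {a<..<b} x)"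
        by (intro tendsto_intros bump_tendsto_indicator)
      then show "(\<lambda>n. w x * of_real (bump a b n x)) \<longlonglongrightarrow> indicator {a<..<b} x *\<^sub>R w x"
        by (simp add: scaleR_conv_of_real mult.commute)
    qed
    show "AE x in lborel. norm (w x * of_real (bump a b n x)) \<le> norm (indicator {a<..<b} x *\<^sub>R w x)" for n
    proof (rule AE_I2)
      fix x
      have "cmod (w x) * \<bar>bump a b n x\<bar> \<le> cmod (w x) * indicator {a<..<b} x"
        by (intro mult_left_mono bump_bounds norm_ge_zero)
      then show "norm (w x * of_real (bump a b n x)) \<le> norm (indicator {a<..<b} x *\<^sub>R w x)"
        by (simp add: norm_mult mult.commute)
    qed
    show "(\<lambda>x. indicator {a<..<b} x *\<^sub>R w x) \<in> borel_measurable lborel"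
      by measurable
  qed
  have eq: "(LINT x:{a<..<b}|lborel. g x) = (LINT x:{a<..<b}|lborel. h x)" for a b
  proof (rule LIMSEQ_unique[OF lim[OF g m(1)]])
    have "(LINT x|lborel. g x * of_real (bump a b n x)) = (LINT x|lborel. h x * of_real (bump a b n x))" for n
    proof -
      have "- (LINT x|lborel. g x * of_real (bump a b n x)) = - (LINT x|lborel. h x * of_real (bump a b n x))"
        using f[unfolded weak_deriv_def, rule_format, OF test_fun_bump[of a b n]] by (rule trans[OF sym])
      then show ?thesis by (simp only: neg_equal_iff_equal)
    qed
    with lim[OF h m(2)] show "(\<lambda>n. LINT x|lborel. g x * of_real (bump a b n x)) \<longlonglongrightarrow> (LINT x:{a<..<b}|lborel. h x)"
      by simp
  qed
  have "AE x in lborel. \<forall>n. indicator {- real n<..<real n} x *\<^sub>R (g x - h x) = 0"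
    unfolding AE_all_countable
  proof
    fix n
    have Int: "indicator A x *\<^sub>R indicator B x *\<^sub>R v = indicator (A \<inter> B) x *\<^sub>R v" for A B and x :: real and v :: complex
      by (auto simp: indicator_def)
    show "AE x in lborel. indicator {- real n<..<real n} x *\<^sub>R (g x - h x) = 0"
    proof (rule AE_eq_0_of_interval_integrals)
      show "integrable lborel (\<lambda>x. indicator {- real n<..<real n} x *\<^sub>R (g x - h x))"
        using set_integral_diff(1)[OF g h] unfolding set_integrable_def by simp
      show "(LINT x:{a<..<b}|lborel. indicator {- real n<..<real n} x *\<^sub>R (g x - h x)) = 0" for a b
      proof -
        have "(LINT x:{a<..<b}|lborel. indicator {- real n<..<real n} x *\<^sub>R (g x - h x)) =
            (LINT x:{max a (- real n)<..<min b (real n)}|lborel. g x - h x)"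
          unfolding set_lebesgue_integral_def Int Int_greaterThanLessThan ..
        then show ?thesis using set_integral_diff(2)[OF g h] eq by simp
      qed
    qed
  qed
  then show ?thesis
  proof eventually_elim
    case (elim x)
    obtain n where "\<bar>x\<bar> < real n" using reals_Archimedean2 by blast
    with elim[rule_format, of n] show ?case by (auto simp: indicator_def split: if_splits)
  qed
qed

text \<open>A continuous classical derivative is a weak one, by integration by parts, hence it agrees almost
everywhere with the weak derivative in \<open>L\<^sup>2\<close>.\<close>

lemma W12_classical_derivative_in_L2:
  assumes "f \<in> W12" and f: "\<And>x. (f has_vector_derivative f' x) (at x)" and f': "continuous_on UNIV f'"
  shows "in_L2 f'"
proof -
  obtain g where g: "in_L2 g" "weak_deriv f g"
    using assms(1) by (auto simp: W12_def)
  have m [measurable]: "f' \<in> borel_measurable lborel" "g \<in> borel_measurable lborel"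
    using f' g(1) by (auto simp: in_L2_def borel_measurable_continuous_onI)
  have "set_integrable lborel {a<..<b} f'" for a b
  proof (rule set_integrable_subset)
    show "set_integrable lborel {a..b} f'"
      unfolding set_integrable_def
      by (rule borel_integrable_compact) (use f' continuous_on_subset in auto)
  qed auto
  then have ae: "AE x in lborel. f' x = g x"
    using weak_deriv_unique weak_deriv_classical[OF f f'] g in_L2_set_integrable m by blast
  have "integrable lborel (\<lambda>x. (cmod (f' x))\<^sup>2) \<longleftrightarrow> integrable lborel (\<lambda>x. (cmod (g x))\<^sup>2)"
    by (rule integrable_cong_AE) (use ae in \<open>auto elim: eventually_mono\<close>)
  with g m show ?thesis by (simp add: in_L2_def)
qed

section \<open>Difference quotients of twice differentiable functions\<close>

lemma lipschitz_of_vector_derivative_bound: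
  fixes f :: "real \<Rightarrow> 'a :: real_normed_vector"
  assumes "convex S" and f: "\<And>x. x \<in> S \<Longrightarrow> (f has_vector_derivative f' x) (at x)"
    and B: "\<And>x. x \<in> S \<Longrightarrow> norm (f' x) \<le> B" and "0 \<le> B"
  shows "B-lipschitz_on S f"
proof (rule bounded_derivative_imp_lipschitz[OF _ \<open>convex S\<close>])
  show "(f has_derivative (\<lambda>h. h *\<^sub>R f' x)) (at x within S)" if "x \<in> S" for x
    using f[OF that] by (auto simp: has_vector_derivative_def intro: has_derivative_at_withinI)
  show "onorm (\<lambda>h. h *\<^sub>R f' x) \<le> B" if "x \<in> S" for x
  proof (rule onorm_le)
    fix h
    have "\<bar>h\<bar> * norm (f' x) \<le> \<bar>h\<bar> * B"
      using B[OF that] by (intro mult_left_mono) auto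
    then show "norm (h *\<^sub>R f' x) \<le> B * norm h"
      by (simp add: mult.commute)
  qed
qed fact

text \<open>The linear remainder has derivative \<open>f'(s) - f'(x)\<close>, which on the segment from \<open>x\<close> to \<open>t\<close> is at
most \<open>M \<bar>t - x\<bar>\<close>; the mean value inequality supplies the other factor.\<close>

lemma lipschitz_taylor_1:
  fixes f :: "real \<Rightarrow> 'a :: real_normed_vector"
  assumes f: "\<And>x. (f has_vector_derivative f' x) (at x)" and lip: "M-lipschitz_on UNIV f'"
  shows "norm (f t - f x - (t - x) *\<^sub>R f' x) \<le> M * (t - x)\<^sup>2"
proof -
  have "(M * \<bar>t - x\<bar>)-lipschitz_on (closed_segment x t) (\<lambda>s. f s - (s - x) *\<^sub>R f' x)"
  proof (rule lipschitz_of_vector_derivative_bound)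
    fix s assume s: "s \<in> closed_segment x t"
    show "((\<lambda>s. f s - (s - x) *\<^sub>R f' x) has_vector_derivative f' s - f' x) (at s)"
      by (auto intro!: derivative_eq_intros f)
    have "norm (f' s - f' x) \<le> M * \<bar>s - x\<bar>"
      using lip unfolding lipschitz_on_def by (auto simp: dist_norm)
    also have "\<dots> \<le> M * \<bar>t - x\<bar>"
      using s lip by (intro mult_left_mono) (auto simp: lipschitz_on_def closed_segment_eq_real_ivl split: if_splits)
    finally show "norm (f' s - f' x) \<le> M * \<bar>t - x\<bar>" .
  qed (use lip in \<open>auto simp: lipschitz_on_def\<close>)
  from lipschitz_onD[OF this, of t x] have "norm (f t - f x - (t - x) *\<^sub>R f' x) \<le> M * \<bar>t - x\<bar> * \<bar>t - x\<bar>"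
    by (simp add: dist_norm algebra_simps)
  then show ?thesis by (simp add: power2_eq_square abs_mult_self_eq mult.assoc)
qed

text \<open>A Taylor expansion of second order, by the mean value inequality for the quadratic remainder \<open>h\<close>
below: differentiability of \<open>f'\<close> at the single point \<open>x\<close> makes its derivative \<open>o(s - x)\<close>.\<close>

lemma diff_quot_diagonal_has_derivative:
  assumes f: "\<And>t. (f has_vector_derivative f1 t) (at t)"
    and f1: "(f1 has_vector_derivative d) (at x)"
  shows "((\<lambda>t. diff_quot f t x) has_vector_derivative d / 2) (at x)"
  unfolding has_vector_derivative_def has_derivative_at_alt
proof (intro conjI allI impI)
  fix e :: real assume "0 < e"
  then obtain \<delta> where "\<delta> > 0"
    and \<delta>: "\<And>s. \<bar>s - x\<bar> < \<delta> \<Longrightarrow> cmod (f1 s - f1 x - (s - x) *\<^sub>R d) \<le> e * \<bar>s - x\<bar>"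
    using f1 unfolding has_vector_derivative_def has_derivative_at_alt by auto
  define h where "h s = f s - (s - x) *\<^sub>R f1 x - ((s - x)\<^sup>2 / 2) *\<^sub>R d" for s
  have h: "(h has_vector_derivative f1 s - f1 x - (s - x) *\<^sub>R d) (at s)" for s
    unfolding h_def by (auto intro!: derivative_eq_intros f)
  have "cmod (diff_quot f t x - diff_quot f x x - (t - x) *\<^sub>R (d / 2)) \<le> e * \<bar>t - x\<bar>"
    if t: "\<bar>t - x\<bar> < \<delta>" for t
  proof (cases "t = x")
    case False
    have "(e * \<bar>t - x\<bar>)-lipschitz_on (closed_segment x t) h"
    proof (rule lipschitz_of_vector_derivative_bound[OF _ h])
      fix s assume "s \<in> closed_segment x t"
      then have s: "\<bar>s - x\<bar> \<le> \<bar>t - x\<bar>"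
        by (auto simp: closed_segment_eq_real_ivl split: if_splits)
      with t have "cmod (f1 s - f1 x - (s - x) *\<^sub>R d) \<le> e * \<bar>s - x\<bar>"
        by (intro \<delta>) simp
      also have "\<dots> \<le> e * \<bar>t - x\<bar>"
        using s \<open>0 < e\<close> by (intro mult_left_mono) auto
      finally show "cmod (f1 s - f1 x - (s - x) *\<^sub>R d) \<le> e * \<bar>t - x\<bar>" .
    qed (use \<open>0 < e\<close> in auto)
    from lipschitz_onD[OF this, of t x]
    have le: "cmod (h t - h x) \<le> e * \<bar>t - x\<bar> * \<bar>t - x\<bar>"
      by (simp add: dist_norm)
    have "diff_quot f t x - diff_quot f x x - (t - x) *\<^sub>R (d / 2) = (h t - h x) / of_real (t - x)"
      using False vector_derivative_at[OF f, of x]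
      by (simp add: diff_quot_def h_def scaleR_conv_of_real power2_eq_square field_simps)
    then have "cmod (diff_quot f t x - diff_quot f x x - (t - x) *\<^sub>R (d / 2)) = cmod (h t - h x) / \<bar>t - x\<bar>"
      by (simp only: norm_divide norm_of_real)
    also have "\<dots> \<le> e * \<bar>t - x\<bar>"
      using le False by (simp add: divide_le_eq)
    finally show ?thesis .
  qed simp
  with \<open>\<delta> > 0\<close> show "\<exists>\<delta>>0. \<forall>t. norm (t - x) < \<delta> \<longrightarrow>
      norm (diff_quot f t x - diff_quot f x x - (t - x) *\<^sub>R (d / 2)) \<le> e * norm (t - x)"
    by auto
qed (rule bounded_linear_scaleR_left)

text \<open>The derivatives are carried as explicit functions because those of products and conjugates are then
given by formulas. Bounds take the place of the decay at infinity in \<open>Winf\<close>, so that closure under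
products is immediate.\<close>

definition bounded_C2 :: "(real \<Rightarrow> complex) \<Rightarrow> (real \<Rightarrow> complex) \<Rightarrow> (real \<Rightarrow> complex) \<Rightarrow> bool" where
  "bounded_C2 f f1 f2 \<longleftrightarrow>
     (\<forall>x. (f has_vector_derivative f1 x) (at x)) \<and> (\<forall>x. (f1 has_vector_derivative f2 x) (at x)) \<and>
     continuous_on UNIV f2 \<and> bounded (range f) \<and> bounded (range f1) \<and> bounded (range f2)"

text \<open>The partial derivative of \<open>diff_quot f\<close> in its first variable, as a closed formula whose joint
measurability is visible. The diagonal value is \<open>f''(x) / 2\<close>.\<close>

definition dx_diff_quot ::
    "(real \<Rightarrow> complex) \<Rightarrow> (real \<Rightarrow> complex) \<Rightarrow> (real \<Rightarrow> complex) \<Rightarrow> real \<Rightarrow> real \<Rightarrow> complex" where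
  "dx_diff_quot f f1 f2 x y =
     (if x = y then f2 x / 2 else (f1 x - (f x - f y) / of_real (x - y)) / of_real (x - y))"

lemma bounded_C2_derivs:
  assumes "bounded_C2 f f1 f2"
  shows "(f has_vector_derivative f1 x) (at x)" "(f1 has_vector_derivative f2 x) (at x)"
  using assms by (auto simp: bounded_C2_def)

lemma bounded_C2_Dx: "bounded_C2 f f1 f2 \<Longrightarrow> Dx f x = f1 x"
  using bounded_C2_derivs(1) vector_derivative_at by blast

lemma bounded_C2_continuous:
  assumes "bounded_C2 f f1 f2"
  shows "continuous_on UNIV f" "continuous_on UNIV f1" "continuous_on UNIV f2"
  using assms by (auto simp: bounded_C2_def intro!: continuous_at_imp_continuous_on has_vector_derivative_continuous)

lemma bounded_C2_measurable:
  assumes "bounded_C2 f f1 f2"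
  shows "f \<in> borel_measurable borel" "f1 \<in> borel_measurable borel" "f2 \<in> borel_measurable borel"
  using bounded_C2_continuous[OF assms] by (auto intro: borel_measurable_continuous_onI)

lemma dx_diff_quot_has_derivative:
  assumes f: "bounded_C2 f f1 f2"
  shows "((\<lambda>t. diff_quot f t y) has_vector_derivative dx_diff_quot f f1 f2 x y) (at x)"
proof (cases "x = y")
  case True
  then show ?thesis
    using diff_quot_diagonal_has_derivative[OF bounded_C2_derivs(1,2)[OF f]] by (simp add: dx_diff_quot_def)
next
  case False
  have r: "((\<lambda>t. inverse (t - y)) has_real_derivative - (inverse (x - y))\<^sup>2) (at x)"
    using False by (auto intro!: derivative_eq_intros simp: power2_eq_square)
  have "((\<lambda>t. (f t - f y) * of_real (inverse (t - y))) has_vector_derivative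
      (f x - f y) * of_real (- (inverse (x - y))\<^sup>2) + (f1 x - 0) * of_real (inverse (x - y))) (at x)"
    by (rule has_vector_derivative_mult has_vector_derivative_of_real has_vector_derivative_diff
        has_vector_derivative_const bounded_C2_derivs(1)[OF f] r)+
  also have "(f x - f y) * of_real (- (inverse (x - y))\<^sup>2) + (f1 x - 0) * of_real (inverse (x - y))
      = dx_diff_quot f f1 f2 x y"
    using False by (simp add: dx_diff_quot_def divide_inverse algebra_simps power2_eq_square)
  finally show ?thesis
    by (rule has_vector_derivative_transform_within_open[of _ _ _ "- {y}"])
       (use False in \<open>auto simp: diff_quot_def divide_inverse\<close>)
qed

text \<open>For \<open>\<bar>x - y\<bar> < 1\<close> the Taylor remainder gives the bound \<open>sup \<bar>f''\<bar>\<close>; for \<open>\<bar>x - y\<bar> \<ge> 1\<close> the two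
terms of the quotient rule are bounded separately. On each region the weight \<open>1 / (1 + (x - y)\<^sup>2)\<close>
is comparable with what is needed.\<close>

lemma dx_diff_quot_bound:
  assumes f: "bounded_C2 f f1 f2"
  obtains C where "C \<ge> 0" "\<And>x y. cmod (dx_diff_quot f f1 f2 x y) \<le> cmod (f1 x) + C * inverse (1 + (x - y)\<^sup>2)"
proof -
  obtain B where B: "B > 0" "\<And>x. cmod (f x) \<le> B"
    using f unfolding bounded_C2_def bounded_pos by auto
  obtain M where M: "M > 0" "\<And>x. cmod (f2 x) \<le> M"
    using f unfolding bounded_C2_def bounded_pos by auto
  have lip: "M-lipschitz_on UNIV f1"
    by (rule lipschitz_of_vector_derivative_bound[OF _ bounded_C2_derivs(2)[OF f]]) (use M in \<open>auto simp: less_imp_le\<close>)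
  have near: "cmod (dx_diff_quot f f1 f2 x y) \<le> M" for x y
  proof (cases "x = y")
    case True
    with M(2)[of x] M(1) show ?thesis by (simp add: dx_diff_quot_def norm_divide)
  next
    case False
    have "dx_diff_quot f f1 f2 x y = (f y - f x - (y - x) *\<^sub>R f1 x) / of_real ((x - y)\<^sup>2)"
      using False by (simp add: dx_diff_quot_def scaleR_conv_of_real power2_eq_square field_simps)
    then have "cmod (dx_diff_quot f f1 f2 x y) = cmod (f y - f x - (y - x) *\<^sub>R f1 x) / (x - y)\<^sup>2"
      by (simp only: norm_divide norm_of_real abs_power2)
    also have "\<dots> \<le> M"
      using False lipschitz_taylor_1[OF bounded_C2_derivs(1)[OF f] lip, of y x]
      by (simp add: divide_le_eq power2_commute)
    finally show ?thesis .
  qed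
  have far: "cmod (dx_diff_quot f f1 f2 x y) \<le> cmod (f1 x) + 2 * B * inverse ((x - y)\<^sup>2)" if "1 \<le> \<bar>x - y\<bar>" for x y
  proof -
    have "x \<noteq> y" using that by auto
    then have "dx_diff_quot f f1 f2 x y = f1 x / of_real (x - y) - (f x - f y) / of_real ((x - y)\<^sup>2)"
      by (simp add: dx_diff_quot_def power2_eq_square diff_divide_distrib)
    then have "cmod (dx_diff_quot f f1 f2 x y) \<le> cmod (f1 x / of_real (x - y)) + cmod ((f x - f y) / of_real ((x - y)\<^sup>2))"
      by (simp only: norm_triangle_ineq4)
    also have "cmod (f1 x / of_real (x - y)) \<le> cmod (f1 x)"
    proof -
      have "cmod (f1 x) * 1 \<le> cmod (f1 x) * \<bar>x - y\<bar>" using that by (intro mult_left_mono) auto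
      then show ?thesis using that by (simp only: norm_divide norm_of_real) (simp add: divide_le_eq)
    qed
    also have "cmod ((f x - f y) / of_real ((x - y)\<^sup>2)) = cmod (f x - f y) * inverse ((x - y)\<^sup>2)"
      by (simp only: norm_divide norm_of_real abs_power2) (simp only: divide_inverse)
    also have "\<dots> \<le> 2 * B * inverse ((x - y)\<^sup>2)"
      using norm_triangle_ineq4[of "f x" "f y"] B(2)[of x] B(2)[of y] by (intro mult_right_mono) auto
    finally show ?thesis by simp
  qed
  have "cmod (dx_diff_quot f f1 f2 x y) \<le> cmod (f1 x) + (2 * M + 4 * B) * inverse (1 + (x - y)\<^sup>2)" for x y
  proof (cases "1 \<le> \<bar>x - y\<bar>")
    case True
    then have 1: "1 \<le> (x - y)\<^sup>2"
      using abs_le_square_iff[of 1 "x - y"] by simp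
    then have "inverse ((x - y)\<^sup>2) \<le> 2 * inverse (1 + (x - y)\<^sup>2)"
      by (simp add: divide_simps)
    then have "2 * B * inverse ((x - y)\<^sup>2) \<le> 2 * B * (2 * inverse (1 + (x - y)\<^sup>2))"
      using B(1) by (intro mult_left_mono) auto
    then have "2 * B * inverse ((x - y)\<^sup>2) \<le> 4 * B * inverse (1 + (x - y)\<^sup>2)"
      by simp
    also have "\<dots> \<le> (2 * M + 4 * B) * inverse (1 + (x - y)\<^sup>2)"
      using M(1) by (intro mult_right_mono) auto
    finally show ?thesis using far[OF True] by linarith
  next
    case False
    then have "(x - y)\<^sup>2 \<le> 1" by (simp add: abs_square_le_1)
    then have "M * 1 \<le> M * (2 * inverse (1 + (x - y)\<^sup>2))"
      using M(1) by (intro mult_left_mono) (auto simp: field_simps add_pos_nonneg)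
    also have "\<dots> \<le> (2 * M + 4 * B) * inverse (1 + (x - y)\<^sup>2)"
      using B(1) by (simp add: algebra_simps)
    finally show ?thesis using near[of x y] norm_ge_zero[of "f1 x"] by linarith
  qed
  then show ?thesis using that[of "2 * M + 4 * B"] B(1) M(1) by auto
qed

lemma bounded_C2_cnj:
  assumes "bounded_C2 f f1 f2"
  shows "bounded_C2 (\<lambda>x. cnj (f x)) (\<lambda>x. cnj (f1 x)) (\<lambda>x. cnj (f2 x))"
  using assms unfolding bounded_C2_def bounded_iff
  by (auto intro!: bounded_linear.has_vector_derivative[OF bounded_linear_cnj] continuous_intros)

lemma C0_bounded_range:
  assumes "h \<in> C0"
  shows "bounded (range h)"
proof -
  have "\<forall>\<^sub>F x in at_infinity. dist (h x) 0 < 1"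
    using assms unfolding C0_def by (intro tendstoD) auto
  then obtain b where b: "\<And>x. b \<le> \<bar>x\<bar> \<Longrightarrow> cmod (h x) < 1"
    unfolding eventually_at_infinity by auto
  have "compact (h ` {-b..b})"
    using assms unfolding C0_def by (intro compact_continuous_image) (auto intro: continuous_on_subset)
  then have "bounded (h ` {-b..b} \<union> ball 0 1)"
    using compact_imp_bounded by auto
  moreover have "range h \<subseteq> h ` {-b..b} \<union> ball 0 1"
    using b by (force simp: abs_le_iff not_le)
  ultimately show ?thesis by (rule bounded_subset)
qed

text \<open>Only the bound for \<open>f'\<close> is missing from the definition of \<open>Winf\<close>. It is Landau's:
\<open>f'(x)\<close> differs from \<open>f(x + 1) - f(x)\<close> by at most \<open>sup \<bar>f''\<bar>\<close>.\<close>

lemma Winf_bounded_C2: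
  assumes "f \<in> Winf"
  shows "bounded_C2 f (Dx f) (Dx (Dx f))"
proof -
  have d: "(f has_vector_derivative Dx f x) (at x)" "(Dx f has_vector_derivative Dx (Dx f) x) (at x)" for x
    using assms by (auto simp: Winf_def vector_derivative_works)
  have b: "bounded (range f)" "bounded (range (Dx (Dx f)))"
    using assms C0_bounded_range by (auto simp: Winf_def)
  obtain B where B: "\<And>x. cmod (f x) \<le> B"
    using b unfolding bounded_iff by auto
  obtain M where M: "M > 0" "\<And>x. cmod (Dx (Dx f) x) \<le> M"
    using b unfolding bounded_pos by auto
  have lip: "M-lipschitz_on UNIV (Dx f)"
    by (rule lipschitz_of_vector_derivative_bound[OF _ d(2)]) (use M in \<open>auto simp: less_imp_le\<close>)
  have "cmod (Dx f x) \<le> M + 2 * B" for x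
  proof -
    have "cmod (f (x + 1) - f x - Dx f x) \<le> M"
      using lipschitz_taylor_1[OF d(1) lip, of "x + 1" x] by simp
    moreover have "cmod (Dx f x) \<le> cmod (f (x + 1) - f x - Dx f x) + (cmod (f (x + 1)) + cmod (f x))"
      by norm
    ultimately show ?thesis using B[of x] B[of "x + 1"] by linarith
  qed
  then have "bounded (range (Dx f))" unfolding bounded_iff by auto
  with assms d b show ?thesis
    by (simp add: bounded_C2_def Winf_def C0_def)
qed

lemma bounded_C2_mult:
  assumes f: "bounded_C2 f f1 f2" and g: "bounded_C2 g g1 g2"
  shows "bounded_C2 (\<lambda>x. f x * g x) (\<lambda>x. f x * g1 x + f1 x * g x)
           (\<lambda>x. (f x * g2 x + f1 x * g1 x) + (f1 x * g1 x + f2 x * g x))"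
proof -
  have bm: "bounded (range (\<lambda>x. u x * v x))" if "bounded (range u)" "bounded (range v)"
    for u v :: "real \<Rightarrow> complex"
  proof -
    obtain a where a: "\<And>x. cmod (u x) \<le> a"
      using \<open>bounded (range u)\<close> unfolding bounded_iff by auto
    obtain b where b: "\<And>x. cmod (v x) \<le> b"
      using \<open>bounded (range v)\<close> unfolding bounded_iff by auto
    from a b have "cmod (u x * v x) \<le> a * b" for x
      unfolding norm_mult by (intro mult_mono) (auto intro: order_trans[OF norm_ge_zero])
    then show ?thesis unfolding bounded_iff by auto
  qed
  have ba: "bounded (range (\<lambda>x. u x + v x))" if "bounded (range u)" "bounded (range v)"
    for u v :: "real \<Rightarrow> complex"
    using bounded_plus_comp[of u UNIV v] that by simp
  note d = bounded_C2_derivs[OF f] bounded_C2_derivs[OF g]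
  have "((\<lambda>x. f x * g x) has_vector_derivative f x * g1 x + f1 x * g x) (at x)" for x
    by (rule has_vector_derivative_mult d)+
  moreover have "((\<lambda>x. f x * g1 x + f1 x * g x) has_vector_derivative
      (f x * g2 x + f1 x * g1 x) + (f1 x * g1 x + f2 x * g x)) (at x)" for x
    by (rule has_vector_derivative_add has_vector_derivative_mult d)+
  moreover have "continuous_on UNIV (\<lambda>x. (f x * g2 x + f1 x * g1 x) + (f1 x * g1 x + f2 x * g x))"
    by (intro continuous_intros bounded_C2_continuous[OF f] bounded_C2_continuous[OF g])
  moreover have "bounded (range f)" "bounded (range f1)" "bounded (range f2)"
      "bounded (range g)" "bounded (range g1)" "bounded (range g2)"
    using f g by (simp_all add: bounded_C2_def)
  ultimately show ?thesis
    unfolding bounded_C2_def by (intro conjI allI bm ba)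
qed

text \<open>Off the diagonal, \<open>f(y)\<close> and \<open>g(y)\<close> are expressed through the difference quotients, which leaves a
rational identity. On the diagonal it is half of the product rule for second derivatives, the
cross term \<open>2 f' g'\<close> becoming the product of the difference quotients.\<close>

lemma dx_diff_quot_mult:
  assumes "bounded_C2 f f1 f2" and "bounded_C2 g g1 g2"
  shows "dx_diff_quot (\<lambda>x. f x * g x) (\<lambda>x. f x * g1 x + f1 x * g x)
           (\<lambda>x. (f x * g2 x + f1 x * g1 x) + (f1 x * g1 x + f2 x * g x)) x y =
         f x * dx_diff_quot g g1 g2 x y + dx_diff_quot f f1 f2 x y * g x + diff_quot f x y * diff_quot g x y"
proof (cases "x = y")
  case True
  then show ?thesis
    using assms by (simp add: dx_diff_quot_def diff_quot_def bounded_C2_Dx field_simps)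
next
  case False
  define r where "r = complex_of_real (x - y)"
  define a where "a = diff_quot f x y"
  define b where "b = diff_quot g x y"
  have r: "r \<noteq> 0" and y: "f y = f x - a * r" "g y = g x - b * r"
    using False by (auto simp: r_def a_def b_def diff_quot_def)
  have f': "dx_diff_quot f f1 f2 x y = (f1 x - a) / r" and g': "dx_diff_quot g g1 g2 x y = (g1 x - b) / r"
    using False unfolding dx_diff_quot_def a_def b_def r_def diff_quot_def by auto
  have "(f x * g x - f y * g y) / r = f x * b + a * g x - a * b * r"
    using r unfolding y by (simp add: field_simps)
  with False have "dx_diff_quot (\<lambda>x. f x * g x) (\<lambda>x. f x * g1 x + f1 x * g x)
           (\<lambda>x. (f x * g2 x + f1 x * g1 x) + (f1 x * g1 x + f2 x * g x)) x y =
      (f x * g1 x + f1 x * g x - (f x * b + a * g x - a * b * r)) / r"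
    unfolding dx_diff_quot_def r_def[symmetric] by simp
  also have "\<dots> = f x * ((g1 x - b) / r) + (f1 x - a) / r * g x + a * b"
    using r by (simp add: field_simps)
  finally show ?thesis
    unfolding f' g' a_def[symmetric] b_def[symmetric] .
qed

lemma diff_quot_lipschitz:
  assumes "L-lipschitz_on UNIV f"
  shows "(\<lambda>y. diff_quot f x y) \<in> borel_measurable borel"
    and "cmod (diff_quot f x y) \<le> L + cmod (Dx f x)"
proof -
  have [measurable]: "f \<in> borel_measurable borel"
    using lipschitz_on_continuous_on[OF assms] by (rule borel_measurable_continuous_onI)
  show "(\<lambda>y. diff_quot f x y) \<in> borel_measurable borel"
    unfolding diff_quot_def by measurable
  have "0 \<le> L" using assms lipschitz_on_nonneg by blast
  show "cmod (diff_quot f x y) \<le> L + cmod (Dx f x)"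
  proof (cases "x = y")
    case False
    have "cmod (f x - f y) \<le> L * \<bar>x - y\<bar>"
      using lipschitz_onD[OF assms, of x y] by (simp add: dist_norm)
    then have "cmod ((f x - f y) / of_real (x - y)) \<le> L"
      using False by (simp only: norm_divide norm_of_real) (simp add: divide_le_eq)
    with False have "cmod (diff_quot f x y) \<le> L"
      unfolding diff_quot_def by simp
    then show ?thesis
      using norm_ge_zero[of "Dx f x"] by linarith
  qed (use \<open>0 \<le> L\<close> in \<open>simp add: diff_quot_def\<close>)
qed

lemma diff_quot_cnj: "x \<noteq> y \<Longrightarrow> diff_quot (\<lambda>t. cnj (g t)) x y = cnj (diff_quot g x y)"
  by (simp add: diff_quot_def)

lemma lipschitz_on_cnj: "L-lipschitz_on S g \<Longrightarrow> L-lipschitz_on S (\<lambda>t. cnj (g t))"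
  by (simp add: lipschitz_on_def dist_norm flip: complex_cnj_diff)

lemma bounded_C2_lipschitz:
  assumes "bounded_C2 f f1 f2"
  obtains L where "L-lipschitz_on UNIV f"
proof -
  obtain M where "M > 0" "\<And>x. cmod (f1 x) \<le> M"
    using assms unfolding bounded_C2_def bounded_pos by auto
  then have "M-lipschitz_on UNIV f"
    by (intro lipschitz_of_vector_derivative_bound[OF convex_UNIV bounded_C2_derivs(1)[OF assms]])
       (auto simp: less_imp_le)
  then show ?thesis using that by blast
qed

lemma bounded_C2_diff_quot_cnj:
  assumes "bounded_C2 f f1 f2"
  shows "diff_quot (\<lambda>t. cnj (f t)) x y = cnj (diff_quot f x y)"
  using bounded_C2_Dx[OF assms] bounded_C2_Dx[OF bounded_C2_cnj[OF assms]]
  by (cases "x = y") (simp_all add: diff_quot_def)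

lemma dx_diff_quot_measurable:
  assumes "bounded_C2 f f1 f2"
  shows "case_prod (dx_diff_quot f f1 f2) \<in> borel_measurable (borel \<Otimes>\<^sub>M borel)"
proof -
  note [measurable] = bounded_C2_measurable[OF assms]
  show ?thesis
    unfolding dx_diff_quot_def by measurable
qed

section \<open>Integrability\<close>

lemma integrable_lorentzian: "integrable lborel (\<lambda>x. inverse (1 + (x - y)\<^sup>2) :: real)"
proof -
  have "integrable lborel (\<lambda>x. inverse (1 + x\<^sup>2) :: real)"
    using integrable_inverse_1_plus_square by (simp add: set_integrable_def einterval_eq)
  from lborel_integrable_real_affine[OF this, of 1 "- y"] show ?thesis
    by (simp add: add.commute)
qed

lemma integral_lorentzian_shift:
  "(LINT x|lborel. inverse (1 + (x - y)\<^sup>2)) = (LINT x|lborel. inverse (1 + x\<^sup>2) :: real)"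
  using lborel_integral_real_affine[of 1 "\<lambda>x. inverse (1 + x\<^sup>2)" "- y"] by (simp add: add.commute)

text \<open>The bound on the norm integral is uniform in \<open>y\<close>, which is what makes it integrable against a finite
measure in \<open>y\<close>.\<close>

lemma integrable_dominated_lorentzian:
  fixes F :: "real \<Rightarrow> 'a :: {banach, second_countable_topology}"
  assumes "F \<in> borel_measurable lborel" and p: "integrable lborel p"
    and bound: "\<And>x. norm (F x) \<le> p x + C * inverse (1 + (x - y)\<^sup>2)"
  shows "integrable lborel F"
    and "(LINT x|lborel. norm (F x)) \<le> (LINT x|lborel. p x) + C * (LINT x|lborel. inverse (1 + x\<^sup>2))"
proof -
  have i: "integrable lborel (\<lambda>x. p x + C * inverse (1 + (x - y)\<^sup>2))"
    by (intro Bochner_Integration.integrable_add p integrable_mult_right integrable_lorentzian)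
  show F: "integrable lborel F"
    by (rule Bochner_Integration.integrable_bound[OF i])
       (use assms(1) bound in \<open>auto intro: order_trans[OF bound abs_ge_self]\<close>)
  have "(LINT x|lborel. norm (F x)) \<le> (LINT x|lborel. p x + C * inverse (1 + (x - y)\<^sup>2))"
    by (intro integral_mono integrable_norm F i bound)
  also have "\<dots> = (LINT x|lborel. p x) + (LINT x|lborel. C * inverse (1 + (x - y)\<^sup>2))"
    by (intro Bochner_Integration.integral_add p integrable_mult_right integrable_lorentzian)
  also have "(LINT x|lborel. C * inverse (1 + (x - y)\<^sup>2)) = C * (LINT x|lborel. inverse (1 + x\<^sup>2))"
    by (simp add: integral_lorentzian_shift)
  finally show "(LINT x|lborel. norm (F x)) \<le> (LINT x|lborel. p x) + C * (LINT x|lborel. inverse (1 + x\<^sup>2))" .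
qed

lemma borel_measurable_cnj [measurable]: "cnj \<in> borel_measurable borel"
  by (intro borel_measurable_continuous_onI continuous_intros)

lemma integrable_L2_mult:
  assumes "in_L2 u" and "in_L2 v"
  shows "integrable lborel (\<lambda>x. u x * v x)"
proof (rule Bochner_Integration.integrable_bound)
  show "integrable lborel (\<lambda>x. (cmod (u x))\<^sup>2 + (cmod (v x))\<^sup>2)"
    using assms by (auto simp: in_L2_def)
  have "cmod (u x * v x) \<le> (cmod (u x))\<^sup>2 + (cmod (v x))\<^sup>2" for x
  proof -
    have "0 \<le> cmod (u x) * cmod (v x)" by simp
    then show ?thesis
      using sum_squares_bound[of "cmod (u x)" "cmod (v x)"] unfolding norm_mult by linarith
  qed
  then show "AE x in lborel. norm (u x * v x) \<le> norm ((cmod (u x))\<^sup>2 + (cmod (v x))\<^sup>2)"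
    by (auto intro: order_trans[OF _ abs_ge_self])
qed (use assms in \<open>auto simp: in_L2_def\<close>)

lemma in_L2_cnj: "in_L2 u \<Longrightarrow> in_L2 (\<lambda>x. cnj (u x))"
  by (auto simp: in_L2_def)

lemma in_L2_scale: "in_L2 u \<Longrightarrow> in_L2 (\<lambda>x. a * u x)"
  by (auto simp: in_L2_def norm_mult power_mult_distrib)

lemma in_L2_add:
  assumes u: "in_L2 u" and v: "in_L2 v"
  shows "in_L2 (\<lambda>x. u x + v x)"
  unfolding in_L2_def
proof
  show m: "(\<lambda>x. u x + v x) \<in> borel_measurable lborel"
    using assms by (auto simp: in_L2_def)
  have bound: "(cmod (u x + v x))\<^sup>2 \<le> 2 * (cmod (u x))\<^sup>2 + 2 * (cmod (v x))\<^sup>2" for x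
  proof -
    have "(cmod (u x + v x))\<^sup>2 \<le> (cmod (u x) + cmod (v x))\<^sup>2"
      by (intro power_mono norm_triangle_ineq norm_ge_zero)
    also have "\<dots> \<le> 2 * (cmod (u x))\<^sup>2 + 2 * (cmod (v x))\<^sup>2"
      using sum_squares_bound[of "cmod (u x)" "cmod (v x)"] by (simp add: power2_sum)
    finally show ?thesis .
  qed
  have "integrable lborel (\<lambda>x. 2 * (cmod (u x))\<^sup>2 + 2 * (cmod (v x))\<^sup>2)"
    using assms by (auto simp: in_L2_def)
  then show "integrable lborel (\<lambda>x. (cmod (u x + v x))\<^sup>2)"
    by (rule Bochner_Integration.integrable_bound)
       (use m bound in auto)
qed

text \<open>Expanding the square, \<open>\<parallel>c f - u\<parallel>\<^sup>2 = c\<^sup>2 \<parallel>f\<parallel>\<^sup>2 - 2 c Re \<langle>u, f\<rangle> + \<parallel>u\<parallel>\<^sup>2\<close>, and the last two terms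
are nonnegative. This turns the quadratic-form condition into the Hille--Yosida one.\<close>

lemma L2_norm_le_of_Re_inner_nonpos:
  assumes f: "in_L2 f" and u: "in_L2 u" and le: "Re (L2_inner u f) \<le> 0" and "0 < c"
  shows "c * L2_norm f \<le> L2_norm (\<lambda>x. of_real c * f x - u x)"
proof -
  have i: "integrable lborel (\<lambda>x. u x * cnj (f x))"
    by (rule integrable_L2_mult[OF u in_L2_cnj[OF f]])
  have i2: "integrable lborel (\<lambda>x. (cmod (f x))\<^sup>2)" "integrable lborel (\<lambda>x. (cmod (u x))\<^sup>2)"
    using f u by (auto simp: in_L2_def)
  have expand: "(cmod (of_real c * f x - u x))\<^sup>2 =
      c\<^sup>2 * (cmod (f x))\<^sup>2 - 2 * c * Re (u x * cnj (f x)) + (cmod (u x))\<^sup>2" for x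
    unfolding cmod_power2 by (simp add: power2_eq_square algebra_simps)
  have "c\<^sup>2 * (LINT x|lborel. (cmod (f x))\<^sup>2) \<le>
      c\<^sup>2 * (LINT x|lborel. (cmod (f x))\<^sup>2) - 2 * c * Re (L2_inner u f) + (LINT x|lborel. (cmod (u x))\<^sup>2)"
  proof -
    have "2 * c * Re (L2_inner u f) \<le> 0"
      using le \<open>0 < c\<close> by (intro mult_nonneg_nonpos) auto
    moreover have "0 \<le> (LINT x|lborel. (cmod (u x))\<^sup>2)"
      by (intro Bochner_Integration.integral_nonneg) simp
    ultimately show ?thesis by linarith
  qed
  also have "\<dots> = (LINT x|lborel. (cmod (of_real c * f x - u x))\<^sup>2)"
    unfolding expand L2_inner_def integral_Re[OF i, symmetric] using i2 integrable_Re[OF i] by simp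
  finally have "sqrt (c\<^sup>2 * (LINT x|lborel. (cmod (f x))\<^sup>2)) \<le> L2_norm (\<lambda>x. of_real c * f x - u x)"
    unfolding L2_norm_def by (rule real_sqrt_le_mono)
  then show ?thesis
    using \<open>0 < c\<close> by (simp add: L2_norm_def real_sqrt_mult)
qed

section \<open>The operator and its carre du champ\<close>

context
  fixes \<nu> :: "real measure"
  assumes finite: "finite_measure \<nu>" and borel: "sets \<nu> = sets borel"
begin

interpretation \<nu>: finite_measure \<nu> by (rule finite)

interpretation P: pair_sigma_finite lborel \<nu> ..

lemma borel_cong [measurable_cong]: "sets \<nu> = sets borel"
  by (rule borel)

lemma integrable_pair_dominated_lorentzian:
  fixes F :: "real \<Rightarrow> real \<Rightarrow> 'a :: {banach, second_countable_topology}"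
  assumes F [measurable]: "case_prod F \<in> borel_measurable (borel \<Otimes>\<^sub>M borel)"
    and p: "integrable lborel p"
    and bound: "\<And>x y. norm (F x y) \<le> p x + C * inverse (1 + (x - y)\<^sup>2)"
  shows "integrable (lborel \<Otimes>\<^sub>M \<nu>) (case_prod F)"
proof -
  interpret Q: pair_sigma_finite \<nu> lborel ..
  let ?G = "\<lambda>(y, x). F x y"
  have [measurable]: "?G \<in> borel_measurable (\<nu> \<Otimes>\<^sub>M lborel)"
    by measurable
  note slice = integrable_dominated_lorentzian[OF _ p bound]
  have "integrable (\<nu> \<Otimes>\<^sub>M lborel) ?G"
  proof (rule Q.Fubini_integrable)
    show "AE y in \<nu>. integrable lborel (\<lambda>x. ?G (y, x))"
      by (auto intro!: AE_I2 slice(1))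
    show "integrable \<nu> (\<lambda>y. LINT x|lborel. norm (?G (y, x)))"
    proof (rule \<nu>.integrable_const_bound)
      show "AE y in \<nu>. norm (LINT x|lborel. norm (?G (y, x)))
          \<le> (LINT x|lborel. p x) + C * (LINT x|lborel. inverse (1 + x\<^sup>2))"
        by (auto intro!: AE_I2 slice(2))
    qed measurable
  qed simp
  from Q.integrable_product_swap[OF this] show ?thesis by simp
qed

lemma D_exists_lipschitz:
  assumes f: "L-lipschitz_on UNIV f" and g: "K-lipschitz_on UNIV g"
  shows "D_exists \<nu> f g x"
  unfolding D_exists_def
proof (rule \<nu>.integrable_const_bound)
  have "cmod (diff_quot f x y * cnj (diff_quot g x y)) \<le> (L + cmod (Dx f x)) * (K + cmod (Dx g x))" for y
    unfolding norm_mult complex_mod_cnj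
    by (intro mult_mono diff_quot_lipschitz[OF f] diff_quot_lipschitz[OF g])
       (auto intro: order_trans[OF norm_ge_zero diff_quot_lipschitz(2)[OF f, of x x]])
  then show "AE y in \<nu>. cmod (diff_quot f x y * cnj (diff_quot g x y)) \<le> (L + cmod (Dx f x)) * (K + cmod (Dx g x))"
    by simp
  note [measurable] = diff_quot_lipschitz(1)[OF f] diff_quot_lipschitz(1)[OF g]
  show "(\<lambda>y. diff_quot f x y * cnj (diff_quot g x y)) \<in> borel_measurable \<nu>"
    by measurable
qed

text \<open>Where \<open>g\<close> is not differentiable, the diagonal values for \<open>g\<close> and for its conjugate need not be
conjugate to each other. This matters only if the measure charges the point \<open>x\<close>, and a finite measure
has countably many atoms.\<close>

lemma D_form_cnj_AE:
  assumes "L-lipschitz_on UNIV f" and "K-lipschitz_on UNIV g"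
  shows "AE x in lborel. D_exists \<nu> f (\<lambda>t. cnj (g t)) x \<and>
           D_form \<nu> f (\<lambda>t. cnj (g t)) x = (LINT y|\<nu>. diff_quot f x y * diff_quot g x y)"
proof -
  have "{x. measure \<nu> {x} \<noteq> 0} \<in> null_sets lborel"
    using countable_imp_null_set_lborel \<nu>.countable_support by blast
  from AE_not_in[OF this] show ?thesis
  proof eventually_elim
    case (elim x)
    then have "{x} \<in> null_sets \<nu>"
      using borel by (intro null_setsI) (auto simp: \<nu>.emeasure_eq_measure)
    from AE_not_in[OF this]
    have ae: "AE y in \<nu>. diff_quot f x y * cnj (diff_quot (\<lambda>t. cnj (g t)) x y) = diff_quot f x y * diff_quot g x y"
      by eventually_elim (simp add: diff_quot_cnj)
    note cg = lipschitz_on_cnj[OF assms(2)]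
    note [measurable] = diff_quot_lipschitz(1)[OF assms(1)] diff_quot_lipschitz(1)[OF assms(2)]
      diff_quot_lipschitz(1)[OF cg]
    have "D_form \<nu> f (\<lambda>t. cnj (g t)) x = (LINT y|\<nu>. diff_quot f x y * diff_quot g x y)"
      unfolding D_form_def by (rule integral_cong_AE[OF _ _ ae]) measurable
    with D_exists_lipschitz[OF assms(1) cg] show ?case by blast
  qed
qed

lemma integrable_diff_quot_mult:
  assumes f: "bounded_C2 f f1 f2" and g: "bounded_C2 g g1 g2"
  shows "integrable \<nu> (\<lambda>y. diff_quot f x y * diff_quot g x y)"
proof -
  obtain L K where "L-lipschitz_on UNIV f" "K-lipschitz_on UNIV g"
    using bounded_C2_lipschitz f g by metis
  from D_exists_lipschitz[OF this(1) lipschitz_on_cnj[OF this(2)]] show ?thesis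
    unfolding D_exists_def bounded_C2_diff_quot_cnj[OF g] by simp
qed

lemma integrable_dx_diff_quot:
  assumes "bounded_C2 f f1 f2"
  shows "integrable \<nu> (dx_diff_quot f f1 f2 x)"
proof -
  obtain C where C: "C \<ge> 0" "\<And>x y. cmod (dx_diff_quot f f1 f2 x y) \<le> cmod (f1 x) + C * inverse (1 + (x - y)\<^sup>2)"
    using dx_diff_quot_bound[OF assms] by blast
  note [measurable] = dx_diff_quot_measurable[OF assms]
  show ?thesis
  proof (rule \<nu>.integrable_const_bound)
    have "cmod (dx_diff_quot f f1 f2 x y) \<le> cmod (f1 x) + C" for y
    proof -
      have "C * inverse (1 + (x - y)\<^sup>2) \<le> C * 1"
        using C(1) by (intro mult_left_mono) (auto simp: inverse_le_1_iff)
      with C(2)[of x y] show ?thesis by linarith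
    qed
    then show "AE y in \<nu>. cmod (dx_diff_quot f f1 f2 x y) \<le> cmod (f1 x) + C" by simp
    show "dx_diff_quot f f1 f2 x \<in> borel_measurable \<nu>" by measurable
  qed
qed

lemma bounded_C2_A_exists: "bounded_C2 f f1 f2 \<Longrightarrow> A_exists \<nu> f x"
  and bounded_C2_dL: "bounded_C2 f f1 f2 \<Longrightarrow> dL \<nu> f x = (LINT y|\<nu>. dx_diff_quot f f1 f2 x y)"
proof -
  assume f: "bounded_C2 f f1 f2"
  have *: "Dx (\<lambda>t. diff_quot f t y) x = dx_diff_quot f f1 f2 x y" for x y
    by (rule vector_derivative_at[OF dx_diff_quot_has_derivative[OF f]])
  show "dL \<nu> f x = (LINT y|\<nu>. dx_diff_quot f f1 f2 x y)"
    unfolding dL_def * ..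
  show "A_exists \<nu> f x"
    unfolding A_exists_def *
    by (intro conjI allI integrable_dx_diff_quot[OF f] differentiableI_vector[OF bounded_C2_derivs(1)[OF f]]
        differentiableI_vector[OF dx_diff_quot_has_derivative[OF f]])
qed

lemma dL_mult:
  assumes f: "bounded_C2 f f1 f2" and g: "bounded_C2 g g1 g2"
  shows "dL \<nu> (\<lambda>t. f t * g t) x =
    f x * dL \<nu> g x + dL \<nu> f x * g x + (LINT y|\<nu>. diff_quot f x y * diff_quot g x y)"
proof -
  have "dL \<nu> (\<lambda>t. f t * g t) x =
      (LINT y|\<nu>. f x * dx_diff_quot g g1 g2 x y + dx_diff_quot f f1 f2 x y * g x + diff_quot f x y * diff_quot g x y)"
    unfolding bounded_C2_dL[OF bounded_C2_mult[OF f g]] dx_diff_quot_mult[OF f g] ..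
  also have "\<dots> = f x * (LINT y|\<nu>. dx_diff_quot g g1 g2 x y) + (LINT y|\<nu>. dx_diff_quot f f1 f2 x y) * g x
      + (LINT y|\<nu>. diff_quot f x y * diff_quot g x y)"
    using integrable_dx_diff_quot[OF f, of x] integrable_dx_diff_quot[OF g, of x]
      integrable_diff_quot_mult[OF f g, of x] by simp
  finally show ?thesis
    by (simp only: bounded_C2_dL[OF f] bounded_C2_dL[OF g])
qed

lemma D_form_carre_du_champ:
  assumes f: "bounded_C2 f f1 f2" and g: "bounded_C2 g g1 g2"
  shows "D_form \<nu> f (\<lambda>t. cnj (g t)) x =
    A_op \<alpha> \<nu> (\<lambda>t. f t * g t) x - f x * A_op \<alpha> \<nu> g x - A_op \<alpha> \<nu> f x * g x"
  by (simp add: A_op_def D_form_def dL_mult[OF f g] bounded_C2_diff_quot_cnj[OF g]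
      bounded_C2_Dx[OF f] bounded_C2_Dx[OF g] bounded_C2_Dx[OF bounded_C2_mult[OF f g]] algebra_simps)

lemma dL_cnj:
  assumes f: "bounded_C2 f f1 f2"
  shows "dL \<nu> (\<lambda>t. cnj (f t)) x = cnj (dL \<nu> f x)"
proof -
  have "dx_diff_quot (\<lambda>t. cnj (f t)) (\<lambda>t. cnj (f1 t)) (\<lambda>t. cnj (f2 t)) x y = cnj (dx_diff_quot f f1 f2 x y)" for y
    by (simp add: dx_diff_quot_def)
  then show ?thesis
    by (simp add: bounded_C2_dL[OF f] bounded_C2_dL[OF bounded_C2_cnj[OF f]])
qed

text \<open>By Fubini the integral in \<open>x\<close> can be taken first, and there the integrand is the derivative of the
difference quotient, which vanishes at infinity.\<close>

lemma integral_dL_eq_0: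
  assumes h: "bounded_C2 h h1 h2" and int: "integrable lborel h1" and lim: "(h \<longlongrightarrow> 0) at_infinity"
  shows "integrable lborel (dL \<nu> h)" and "(LINT x|lborel. dL \<nu> h x) = 0"
proof -
  obtain C where C: "\<And>x y. cmod (dx_diff_quot h h1 h2 x y) \<le> cmod (h1 x) + C * inverse (1 + (x - y)\<^sup>2)"
    using dx_diff_quot_bound[OF h] by blast
  note m [measurable] = dx_diff_quot_measurable[OF h]
  have joint: "integrable (lborel \<Otimes>\<^sub>M \<nu>) (case_prod (dx_diff_quot h h1 h2))"
    by (rule integrable_pair_dominated_lorentzian[OF m integrable_norm[OF int] C])
  from P.integrable_fst'[OF this] show "integrable lborel (dL \<nu> h)"
    unfolding bounded_C2_dL[OF h, abs_def] by simp
  have slice: "(LINT x|lborel. dx_diff_quot h h1 h2 x y) = 0" for y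
  proof (rule integral_derivative_eq_0[OF dx_diff_quot_has_derivative[OF h]])
    show "integrable lborel (\<lambda>x. dx_diff_quot h h1 h2 x y)"
      by (rule integrable_dominated_lorentzian(1)[OF _ integrable_norm[OF int] C]) measurable
    have "\<forall>\<^sub>F x in at_infinity. r \<le> cmod (complex_of_real (x - y))" for r
      unfolding eventually_at_infinity norm_of_real by (rule exI[of _ "r + \<bar>y\<bar>"]) auto
    then have "filterlim (\<lambda>x. complex_of_real (x - y)) at_infinity at_infinity"
      by (subst filterlim_at_infinity[of 0]) auto
    then have "((\<lambda>x. (h x - h y) / complex_of_real (x - y)) \<longlongrightarrow> 0) at_infinity"
      by (intro tendsto_divide_0[of _ "0 - h y"] tendsto_intros lim)
    moreover have "\<forall>\<^sub>F x in at_infinity. (h x - h y) / complex_of_real (x - y) = diff_quot h x y"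
      unfolding eventually_at_infinity by (rule exI[of _ "\<bar>y\<bar> + 1"]) (auto simp: diff_quot_def)
    ultimately show "((\<lambda>x. diff_quot h x y) \<longlongrightarrow> 0) at_infinity"
      by (rule Lim_transform_eventually)
  qed
  show "(LINT x|lborel. dL \<nu> h x) = 0"
    using P.Fubini_integral[OF joint] by (simp add: bounded_C2_dL[OF h] slice)
qed

text \<open>Integrating the pointwise bound in \<open>y\<close> gives \<open>\<bar>dL f\<bar> \<le> N \<bar>f'\<bar> + C W\<close> with \<open>N\<close> the total mass and
\<open>W\<close> the convolution of the measure with \<open>1 / (1 + x\<^sup>2)\<close>. Since \<open>0 \<le> W \<le> N\<close>, integrability of \<open>W\<close>
already yields that of \<open>W\<^sup>2\<close>.\<close>

lemma in_L2_dL: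
  assumes f: "bounded_C2 f f1 f2" and L2: "in_L2 f1"
  shows "in_L2 (dL \<nu> f)"
proof -
  obtain C where C: "C \<ge> 0" "\<And>x y. cmod (dx_diff_quot f f1 f2 x y) \<le> cmod (f1 x) + C * inverse (1 + (x - y)\<^sup>2)"
    using dx_diff_quot_bound[OF f] by blast
  note m [measurable] = dx_diff_quot_measurable[OF f]
  define N where "N = measure \<nu> (space \<nu>)"
  define W where "W x = (LINT y|\<nu>. inverse (1 + (x - y)\<^sup>2))" for x
  have int_w: "integrable \<nu> (\<lambda>y. inverse (1 + (x - y)\<^sup>2))" for x
    by (rule \<nu>.integrable_const_bound[of _ 1]) (auto simp: inverse_le_1_iff)
  have W: "0 \<le> W x" "W x \<le> N" for x
  proof -
    show "0 \<le> W x" unfolding W_def by (intro Bochner_Integration.integral_nonneg) simp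
    have "W x \<le> (LINT y|\<nu>. 1)"
      unfolding W_def by (intro integral_mono int_w) (auto simp: inverse_le_1_iff)
    then show "W x \<le> N" by (simp add: N_def)
  qed
  have int_W: "integrable lborel W"
  proof -
    have "integrable (lborel \<Otimes>\<^sub>M \<nu>) (\<lambda>(x, y). inverse (1 + (x - y)\<^sup>2))"
      by (rule integrable_pair_dominated_lorentzian[where p = "\<lambda>_. 0" and C = 1]) auto
    from P.integrable_fst'[OF this] show ?thesis by (simp add: W_def[abs_def])
  qed
  have "cmod (dL \<nu> f x) \<le> N * cmod (f1 x) + C * W x" for x
  proof -
    have "cmod (dL \<nu> f x) \<le> (LINT y|\<nu>. cmod (dx_diff_quot f f1 f2 x y))"
      unfolding bounded_C2_dL[OF f] by (rule integral_norm_bound)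
    also have "\<dots> \<le> (LINT y|\<nu>. cmod (f1 x) + C * inverse (1 + (x - y)\<^sup>2))"
      by (intro integral_mono integrable_norm integrable_dx_diff_quot[OF f] C(2)
          Bochner_Integration.integrable_add integrable_mult_right int_w) simp
    also have "\<dots> = N * cmod (f1 x) + C * W x"
      using int_w by (simp add: W_def N_def)
    finally show ?thesis .
  qed
  then have bound: "(cmod (dL \<nu> f x))\<^sup>2 \<le> 2 * N\<^sup>2 * (cmod (f1 x))\<^sup>2 + 2 * C\<^sup>2 * N * W x" for x
  proof -
    have "(cmod (dL \<nu> f x))\<^sup>2 \<le> (N * cmod (f1 x) + C * W x)\<^sup>2"
      using \<open>\<And>x. cmod (dL \<nu> f x) \<le> N * cmod (f1 x) + C * W x\<close> by (intro power_mono) auto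
    also have "\<dots> \<le> 2 * (N * cmod (f1 x))\<^sup>2 + 2 * (C * W x)\<^sup>2"
      using sum_squares_bound[of "N * cmod (f1 x)" "C * W x"] by (simp add: power2_sum)
    also have "(C * W x)\<^sup>2 \<le> C\<^sup>2 * (N * W x)"
      unfolding power_mult_distrib using W by (intro mult_left_mono) (auto simp: power2_eq_square intro: mult_right_mono)
    finally show ?thesis by (simp add: power_mult_distrib)
  qed
  have meas [measurable]: "dL \<nu> f \<in> borel_measurable lborel"
    unfolding bounded_C2_dL[OF f, abs_def] by measurable
  show ?thesis
    unfolding in_L2_def
  proof (intro conjI meas)
    have "integrable lborel (\<lambda>x. 2 * N\<^sup>2 * (cmod (f1 x))\<^sup>2 + 2 * C\<^sup>2 * N * W x)"
      using L2 int_W unfolding in_L2_def by (intro Bochner_Integration.integrable_add integrable_mult_right) auto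
    then show "integrable lborel (\<lambda>x. (cmod (dL \<nu> f x))\<^sup>2)"
      by (rule Bochner_Integration.integrable_bound) (auto intro: order_trans[OF bound abs_ge_self])
  qed
qed

lemma in_L2_A_op:
  assumes f: "bounded_C2 f f1 f2" and f1: "in_L2 f1"
  shows "in_L2 (A_op \<alpha> \<nu> f)"
  unfolding A_op_def[abs_def] bounded_C2_Dx[OF f]
  by (intro in_L2_add in_L2_scale in_L2_dL[OF f] f1)

text \<open>The carre du champ identity with \<open>g = cnj f\<close>, where the form is the integral of
\<open>\<bar>\<partial>f\<bar>\<^sup>2\<close>, combined with \<open>\<integral> A(\<bar>f\<bar>\<^sup>2) dx = 0\<close>.\<close>

lemma Re_A_op_inner_nonpos:
  assumes f: "bounded_C2 f f1 f2" and L2: "in_L2 f" "in_L2 f1" and lim: "(f \<longlongrightarrow> 0) at_infinity"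
  shows "Re (L2_inner (A_op \<alpha> \<nu> f) f) \<le> 0"
proof -
  let ?h = "\<lambda>x. f x * cnj (f x)"
  let ?h1 = "\<lambda>x. f x * cnj (f1 x) + f1 x * cnj (f x)"
  note fc = bounded_C2_cnj[OF f]
  note h = bounded_C2_mult[OF f fc]
  have int_h1: "integrable lborel ?h1"
    by (intro Bochner_Integration.integrable_add integrable_L2_mult in_L2_cnj L2)
  have lim_h: "(?h \<longlongrightarrow> 0) at_infinity"
    using tendsto_mult[OF lim tendsto_cnj[OF lim]] by simp
  note dL_h = integral_dL_eq_0[OF h int_h1 lim_h]
  have "(LINT x|lborel. ?h1 x) = 0"
    by (rule integral_derivative_eq_0[OF bounded_C2_derivs(1)[OF h] int_h1 lim_h])
  with dL_h int_h1 have int_A: "integrable lborel (A_op \<alpha> \<nu> ?h)" and A_0: "(LINT x|lborel. A_op \<alpha> \<nu> ?h x) = 0"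
    by (simp_all add: A_op_def[abs_def] bounded_C2_Dx[OF h])
  have pointwise: "2 * Re (A_op \<alpha> \<nu> f x * cnj (f x)) \<le> Re (A_op \<alpha> \<nu> ?h x)" for x
  proof -
    have sq: "diff_quot f x y * cnj (diff_quot f x y) = of_real ((cmod (diff_quot f x y))\<^sup>2)" for y
      by (simp only: complex_norm_square)
    have "D_form \<nu> f f x = of_real (LINT y|\<nu>. (cmod (diff_quot f x y))\<^sup>2)"
      unfolding D_form_def sq by (rule integral_complex_of_real)
    then have "0 \<le> Re (D_form \<nu> f f x)" by simp
    also have "D_form \<nu> f f x = A_op \<alpha> \<nu> ?h x - f x * A_op \<alpha> \<nu> (\<lambda>t. cnj (f t)) x - A_op \<alpha> \<nu> f x * cnj (f x)"
      using D_form_carre_du_champ[OF f fc] by simp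
    also have "A_op \<alpha> \<nu> (\<lambda>t. cnj (f t)) x = cnj (A_op \<alpha> \<nu> f x)"
      by (simp add: A_op_def dL_cnj[OF f] bounded_C2_Dx[OF f] bounded_C2_Dx[OF fc])
    finally show ?thesis by (simp add: algebra_simps)
  qed
  have i: "integrable lborel (\<lambda>x. A_op \<alpha> \<nu> f x * cnj (f x))"
    by (rule integrable_L2_mult[OF in_L2_A_op[OF f L2(2)] in_L2_cnj[OF L2(1)]])
  have "2 * Re (L2_inner (A_op \<alpha> \<nu> f) f) = (LINT x|lborel. 2 * Re (A_op \<alpha> \<nu> f x * cnj (f x)))"
    unfolding L2_inner_def integral_Re[OF i, symmetric] by (simp only: integral_mult_right_zero)
  also have "\<dots> \<le> (LINT x|lborel. Re (A_op \<alpha> \<nu> ?h x))"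
    by (intro integral_mono pointwise integrable_mult_right integrable_Re i int_A)
  also have "\<dots> = 0"
    using int_A A_0 by (simp add: integral_Re)
  finally show ?thesis by simp
qed

end

lemma W2_regularity:
  assumes "f \<in> W2"
  shows "bounded_C2 f (Dx f) (Dx (Dx f))" "in_L2 f" "in_L2 (Dx f)" "(f \<longlongrightarrow> 0) at_infinity"
proof -
  show f: "bounded_C2 f (Dx f) (Dx (Dx f))"
    using assms by (auto simp: W2_def intro: Winf_bounded_C2)
  show "in_L2 f" "(f \<longlongrightarrow> 0) at_infinity"
    using assms by (auto simp: W2_def W12_def Winf_def C0_def)
  show "in_L2 (Dx f)"
    using assms by (intro W12_classical_derivative_in_L2[OF _ bounded_C2_derivs(1)[OF f] bounded_C2_continuous(2)[OF f]])
      (simp add: W2_def)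
qed

theorem proposition18:
  fixes \<nu> :: "real measure"
  assumes "finite_measure \<nu>" and "sets \<nu> = sets borel"
  shows
    "(\<forall>f \<in> W1inf \<inter> W12. \<forall>g \<in> W1inf \<inter> W12. AE x in lborel.
        D_exists \<nu> f (\<lambda>t. cnj (g t)) x \<and>
        D_form \<nu> f (\<lambda>t. cnj (g t)) x = (LINT y|\<nu>. diff_quot f x y * diff_quot g x y)) \<and>
     (\<forall>\<alpha>::real. \<forall>f \<in> W2. \<forall>g \<in> W2. \<forall>x.
        D_exists \<nu> f (\<lambda>t. cnj (g t)) x \<and>
        A_exists \<nu> f x \<and> A_exists \<nu> g x \<and> A_exists \<nu> (\<lambda>t. f t * g t) x \<and>
        D_form \<nu> f (\<lambda>t. cnj (g t)) x =
          A_op \<alpha> \<nu> (\<lambda>t. f t * g t) x - f x * A_op \<alpha> \<nu> g x - A_op \<alpha> \<nu> f x * g x) \<and>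
     (\<forall>\<alpha>::real. \<forall>f \<in> W2. Re (L2_inner (A_op \<alpha> \<nu> f) f) \<le> 0) \<and>
     (\<forall>\<alpha>::real. L2_dissipative W2 (A_op \<alpha> \<nu>))"
proof (intro conjI ballI allI)
  fix f g assume "f \<in> W1inf \<inter> W12" "g \<in> W1inf \<inter> W12"
  then obtain L K where "L-lipschitz_on UNIV f" "K-lipschitz_on UNIV g"
    by (auto simp: W1inf_def)
  then show "AE x in lborel. D_exists \<nu> f (\<lambda>t. cnj (g t)) x \<and>
      D_form \<nu> f (\<lambda>t. cnj (g t)) x = (LINT y|\<nu>. diff_quot f x y * diff_quot g x y)"
    by (rule D_form_cnj_AE[OF assms])
next
  fix \<alpha> x :: real and f g assume f: "f \<in> W2" and g: "g \<in> W2"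
  note f' = W2_regularity(1)[OF f] and g' = W2_regularity(1)[OF g]
  obtain L where L: "L-lipschitz_on UNIV f" using bounded_C2_lipschitz[OF f'] .
  obtain K where K: "K-lipschitz_on UNIV g" using bounded_C2_lipschitz[OF g'] .
  show "D_exists \<nu> f (\<lambda>t. cnj (g t)) x"
    by (rule D_exists_lipschitz[OF assms L lipschitz_on_cnj[OF K]])
  show "A_exists \<nu> f x" "A_exists \<nu> g x" "A_exists \<nu> (\<lambda>t. f t * g t) x"
    by (rule bounded_C2_A_exists[OF assms] f' g' bounded_C2_mult[OF f' g'])+
  show "D_form \<nu> f (\<lambda>t. cnj (g t)) x =
      A_op \<alpha> \<nu> (\<lambda>t. f t * g t) x - f x * A_op \<alpha> \<nu> g x - A_op \<alpha> \<nu> f x * g x"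
    by (rule D_form_carre_du_champ[OF assms f' g'])
next
  fix \<alpha> :: real and f assume f: "f \<in> W2"
  show "Re (L2_inner (A_op \<alpha> \<nu> f) f) \<le> 0"
    by (rule Re_A_op_inner_nonpos[OF assms W2_regularity[OF f]])
next
  fix \<alpha> :: real
  show "L2_dissipative W2 (A_op \<alpha> \<nu>)"
    unfolding L2_dissipative_def
  proof (intro ballI conjI allI impI)
    fix f assume f: "f \<in> W2"
    note r = W2_regularity[OF f]
    show "in_L2 f" by (rule r)
    show A: "in_L2 (A_op \<alpha> \<nu> f)" by (rule in_L2_A_op[OF assms r(1,3)])
    show "c * L2_norm f \<le> L2_norm (\<lambda>x. of_real c * f x - A_op \<alpha> \<nu> f x)" if "0 < c" for c
      by (rule L2_norm_le_of_Re_inner_nonpos[OF r(2) A Re_A_op_inner_nonpos[OF assms r] that])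
  qed
qed

end
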